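(* Fix $\Phi=\Phi_{upwind}$. Let $(r,\eta)\in AC(\mathbb{R}^+,L^\infty_\mu(K))\times AC(\mathbb{R}^+,C_b(D_K))$ be a solution of the Euler Co-NCL system with initial datum $(r_0,\eta_0)$ and with a pointwise monotonic velocity field $V:\mathbb{R}^+\times L^\infty_\mu(K)\to\mathcal{V}^{\mathrm{as}}(D_K)$ which is continuous in time and of the form $$V(r_t(x),r_t(x'))=\alpha(r_t(x))-\alpha(r_t(x')),$$ where $\alpha\in C^1_b(\mathbb{R})$ is increasing on compact sets, i.e. for every compact $\Omega\subset\mathbb{R}$ there is a constant $c>0$ with $\alpha'>c$ on $\Omega$. Assume also that there are constants $C_V,L_V>0$ with $|V_t(g(x),g(x'))|\le C_V$ and $|V_t(g(x),g(x'))-V_t(\tilde g(x),\tilde g(x'))|\le L_V\|g-\tilde g\|_{L^\infty_\mu(K)}$ for all $t\ge0$, $(x,x')\in D_K$, $g,\tilde g\in L^\infty_\mu(K)$. Let $\omega:\mathbb{R}^+\times L^\infty_\mu(K)\times D_K\to\mathbb{R}$ be such that: $(x,y)\mapsto\omega_t[r](x,y)$ is continuous and symmetric on $D_K$; $t\mapsto\omega_t$ is in $L^1([0,T])$ for every $T>0$; $|\omega_t[f](x,y)-\omega_t[g](x,y)|\le L_\omega\|f-g\|_{L^\infty_\mu(K)}$ and $|\omega_t[f](x,y)|\le\tilde C_\omega$ for all $t\ge0$, $(x,y)\in D_K$, $f,g\in L^\infty_\mu(K)$, with constants $L_\omega\ge0$, $\tilde C_\omega>0$; and $$\omega_*:=\inf_{t\ge0}\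 \inf_{(x,x')\in D_K}\ \inf_{r\in L^\infty_\mu(K)\setminus\{0\}}\omega_t[r](x,x')>0 .$$ Suppose $r_0\ge0$, $\int_K r_0\,d\mu=M$, and $\eta_0\in C_b(D_K)$ is symmetric with $\eta_0>0$. Then $$\sup_{t\ge0}\|r_t\|_{L^\infty_\mu(K)}\le\|r_0\|_{L^\infty_\mu(K)},$$ and, for any $t\ge0$, $$\|r_t\|_{L^\infty_\mu(K)}\le\frac{\|r_0\|_{L^\infty_\mu(K)}\,\alpha'_{*,0}\,\eta_*\,M\,e^{\alpha'_{*,0}\eta_*Mt}}{\alpha'_{*,0}\,\eta_*\left[\|r_0\|_{L^\infty_\mu(K)}\,\mu(K)\,(e^{\alpha'_{*,0}\eta_*Mt}-1)+M\right]} .$$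
   Context: $\mu$ is a Borel probability measure on $\mathbb{R}^d$ with compact support $K=\operatorname{supp}\mu$. $D_K:=\{(x,y)\in K\times K:x\ne y\}$; $C_b(D_K)$ is the space of bounded continuous functions with the supremum norm; $\mathcal{V}^{\mathrm{as}}(D_K):=\{v:D_K\to\mathbb{R}:v(x,y)=-v(y,x)\}$; symmetric means $h(x,y)=h(y,x)$. $\mathbb{R}^+=[0,\infty)$. $\Phi_{upwind}(a,b;w)=a\,w_+-b\,w_-$ with $w_\pm=\max\{\pm w,0\}$. A curve is in $AC(\mathbb{R}^+,S)$ if it is absolutely continuous on $[0,T]$ with values in $S$ for each $T>0$. A velocity is pointwise if $V_t[r](x,x')=V_t(r_t(x),r_t(x'))$. A pointwise velocity is monotonic if for $r\in L^\infty_\mu$, any $t\ge0$ and $\mu$-a.e. points $x,y,x'$ (writing $V^\pm=\max\{\pm V,0\}$): $r(x)>r(y)$ implies $V_t^+(r(x),r(x'))>V_t^+(r(y),r(x'))$; $r(x)<r(y)$ implies $V_t^-(r(x),r(x'))>V_t^-(r(y),r(x'))$; $r(x)=r(y)$ implies $V_t(r(x),r(x'))=V_t(r(y),r(x'))$; $r(x)=r(x')$ implies $V_t(r(x),r(x'))=0$. $(r,\eta)$ solves the Euler Co-NCL system with initial datum $(r_0,\eta_0)\in L^\infty_\mu(K)\times C_b(D_K)$ if for $\mu$-a.e. $x\in K$, all $t\ge0$ and all $(x,y)\in D_K$, $$r_t(x)=r_0(x)-\int_0^t\int_{K\setminus\{x\}}\Phi(r_s(x),r_s(y);V_s(r_s(x),r_s(y)))\,\eta_s(x,y)\,d\mu(y)\,ds,$$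 $$\eta_t(x,y)=\eta_0(x,y)+\int_0^t(\omega_s[r](x,y)-\eta_s(x,y))\,ds,$$ with locally time-integrable integrands, where $\omega_s[r]$ means $\omega_s[r_s]$. Notation: $\eta_*:=\inf_{t\ge0}\inf_{(x,x')\in D_K}\eta_t(x,x')$; $\alpha'_{*,0}:=\inf_{y\in[0,\|r_0\|_{L^\infty_\mu(K)}]}\alpha'(y)$.
   Formalization: The second bound is stated for η_* ≠ 0 (and D_K nonempty), since for η_* = 0 the fraction is 0/0 (cancelled, it is the first bound); the strict inequalities in "monotonic", which contradict antisymmetry in general, are taken non-strict. *)

theory Defs
  imports "HOL-Probability.Probability"
begin

definition supp :: "'a::topological_space measure \<Rightarrow> 'a set" where
  "supp \<mu> = {x. \<forall>U. open U \<longrightarrow> x \<in> U \<longrightarrow> emeasure \<mu> U > 0}"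

definition off_diag :: "'a set \<Rightarrow> ('a \<times> 'a) set" where
  "off_diag K = {(x, y). x \<in> K \<and> y \<in> K \<and> x \<noteq> y}"

definition antisym_fun_on :: "('a \<times> 'a) set \<Rightarrow> ('a \<times> 'a \<Rightarrow> real) \<Rightarrow> bool" where
  "antisym_fun_on D v \<longleftrightarrow> (\<forall>(x, y) \<in> D. v (x, y) = - v (y, x))"

definition symmetric_fun_on :: "('a \<times> 'a) set \<Rightarrow> ('a \<times> 'a \<Rightarrow> real) \<Rightarrow> bool" where
  "symmetric_fun_on D h \<longleftrightarrow> (\<forall>(x, y) \<in> D. h (x, y) = h (y, x))"

text \<open>
  Elements of \<open>Linf \<mu>\<close> are representatives: everywhere-defined functions, identified only through
  \<open>Linf_norm\<close>. Pointwise conditions on them are therefore imposed almost everywhere. The complement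
  of \<open>supp \<mu>\<close> is a null set (in a second countable space), so functions on the whole space
  represent functions on the support.
\<close>

definition Linf :: "'a measure \<Rightarrow> ('a \<Rightarrow> real) set" where
  "Linf \<mu> = {f \<in> borel_measurable \<mu>. esssup \<mu> (\<lambda>x. ereal \<bar>f x\<bar>) < \<infinity>}"

definition Linf_norm :: "'a measure \<Rightarrow> ('a \<Rightarrow> real) \<Rightarrow> real" where
  "Linf_norm \<mu> f = real_of_ereal (esssup \<mu> (\<lambda>x. ereal \<bar>f x\<bar>))"

definition Cb :: "'b::topological_space set \<Rightarrow> ('b \<Rightarrow> real) set" where
  "Cb D = {h. continuous_on D h \<and> bounded (h ` D)}"

text \<open>The inserted \<open>0\<close> only matters for empty \<open>D\<close>, where the real supremum is unspecified.\<close>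

definition sup_norm_on :: "'b set \<Rightarrow> ('b \<Rightarrow> real) \<Rightarrow> real" where
  "sup_norm_on D h = Sup (insert 0 ((\<lambda>p. \<bar>h p\<bar>) ` D))"

text \<open>
  Absolutely continuous curves on \<open>[0, T]\<close>, for each \<open>T > 0\<close>, with values in the subset \<open>S\<close> of a
  space of functions seminormed by \<open>N\<close>.
\<close>

definition AC_curve :: "(('b \<Rightarrow> real) \<Rightarrow> real) \<Rightarrow> ('b \<Rightarrow> real) set \<Rightarrow> (real \<Rightarrow> 'b \<Rightarrow> real) \<Rightarrow> bool" where
  "AC_curve N S u \<longleftrightarrow>
     (\<forall>t\<ge>0. u t \<in> S) \<and>
     (\<forall>T>0. \<forall>\<epsilon>>0. \<exists>\<delta>>0. \<forall>(n::nat) a b.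
        (\<forall>i<n. 0 \<le> a i \<and> a i \<le> b i \<and> b i \<le> T) \<longrightarrow>
        disjoint_family_on (\<lambda>i. {a i<..<b i}) {..<n} \<longrightarrow>
        (\<Sum>i<n. b i - a i) < \<delta> \<longrightarrow>
        (\<Sum>i<n. N (\<lambda>x. u (b i) x - u (a i) x)) < \<epsilon>)"

definition C1b :: "(real \<Rightarrow> real) \<Rightarrow> bool" where
  "C1b \<alpha> \<longleftrightarrow> (\<forall>x. \<alpha> differentiable (at x)) \<and> continuous_on UNIV (deriv \<alpha>) \<and>
     bounded (range \<alpha>) \<and> bounded (range (deriv \<alpha>))"

definition increasing_on_compacts :: "(real \<Rightarrow> real) \<Rightarrow> bool" where
  "increasing_on_compacts \<alpha> \<longleftrightarrow> (\<forall>\<Omega>. compact \<Omega> \<longrightarrow> (\<exists>c>0. \<forall>x\<in>\<Omega>. deriv \<alpha> x > c))"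

definition Phi_upwind :: "real \<Rightarrow> real \<Rightarrow> real \<Rightarrow> real" where
  "Phi_upwind a b w = a * max w 0 - b * max (- w) 0"

text \<open>
  \<open>V t g\<close> is the velocity field \<open>V\<^sub>t[g]\<close> on pairs of points; \<open>v t a b\<close> is the function of the values
  \<open>a = g x\<close>, \<open>b = g x'\<close> through which a pointwise velocity field factors.
\<close>

definition pointwise_velocity ::
  "'a measure \<Rightarrow> (real \<Rightarrow> ('a \<Rightarrow> real) \<Rightarrow> 'a \<times> 'a \<Rightarrow> real) \<Rightarrow> (real \<Rightarrow> real \<Rightarrow> real \<Rightarrow> real) \<Rightarrow> bool" where
  "pointwise_velocity \<mu> V v \<longleftrightarrow>
     (\<forall>t\<ge>0. \<forall>g\<in>Linf \<mu>. AE x in \<mu>. AE x' in \<mu>. x \<noteq> x' \<longrightarrow> V t g (x, x') = v t (g x) (g x'))"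

text \<open>
  The inequalities between the positive (negative) parts are non-strict. With strict ones the
  condition could not be met as soon as there are three disjoint sets of positive measure: if
  \<open>g x' > g x > g y\<close>, it would give \<open>v t (g x) (g x') > 0\<close> and, by the same token (with the roles of
  \<open>x\<close> and \<open>x'\<close> exchanged), \<open>v t (g x') (g x) > 0\<close>, contradicting antisymmetry. For
  \<open>v t a b = \<alpha> a - \<alpha> b\<close> with \<open>\<alpha>\<close> increasing both positive parts vanish in this situation.
\<close>

definition monotonic_velocity ::
  "'a measure \<Rightarrow> (real \<Rightarrow> real \<Rightarrow> real \<Rightarrow> real) \<Rightarrow> bool" where
  "monotonic_velocity \<mu> v \<longleftrightarrow>
     (\<forall>g\<in>Linf \<mu>. \<forall>t\<ge>0. AE x in \<mu>. AE y in \<mu>. AE x' in \<mu>.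
        (g x > g y \<longrightarrow> max (v t (g x) (g x')) 0 \<ge> max (v t (g y) (g x')) 0) \<and>
        (g x < g y \<longrightarrow> max (- v t (g x) (g x')) 0 \<ge> max (- v t (g y) (g x')) 0) \<and>
        (g x = g y \<longrightarrow> v t (g x) (g x') = v t (g y) (g x')) \<and>
        (g x = g x' \<longrightarrow> v t (g x) (g x') = 0))"

definition Euler_CoNCL_solution ::
  "'a::topological_space measure \<Rightarrow> (real \<Rightarrow> real \<Rightarrow> real \<Rightarrow> real) \<Rightarrow> (real \<Rightarrow> real \<Rightarrow> real \<Rightarrow> real) \<Rightarrow>
   (real \<Rightarrow> ('a \<Rightarrow> real) \<Rightarrow> 'a \<times> 'a \<Rightarrow> real) \<Rightarrow> ('a \<Rightarrow> real) \<Rightarrow> ('a \<times> 'a \<Rightarrow> real) \<Rightarrow>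
   (real \<Rightarrow> 'a \<Rightarrow> real) \<Rightarrow> (real \<Rightarrow> 'a \<times> 'a \<Rightarrow> real) \<Rightarrow> bool" where
  "Euler_CoNCL_solution \<mu> \<Phi> v \<omega> r0 \<eta>0 r \<eta> \<longleftrightarrow>
     (let K = supp \<mu>;
          flux = (\<lambda>x s. LINT y:K - {x}|\<mu>. \<Phi> (r s x) (r s y) (v s (r s x) (r s y)) * \<eta> s (x, y))
      in
        (AE x in \<mu>. x \<in> K \<longrightarrow>
           (\<forall>T>0. set_integrable lborel {0..T} (flux x)) \<and>
           (\<forall>t\<ge>0. r t x = r0 x - (LINT s:{0..t}|lborel. flux x s))) \<and>
        (\<forall>p \<in> off_diag K.
           (\<forall>T>0. set_integrable lborel {0..T} (\<lambda>s. \<omega> s (r s) p - \<eta> s p)) \<and>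
           (\<forall>t\<ge>0. \<eta> t p = \<eta>0 p + (LINT s:{0..t}|lborel. \<omega> s (r s) p - \<eta> s p))))"

text \<open>
  The infima over pairs are taken in the extended reals, so that they are well behaved when \<open>D\<close> is
  empty, i.e. when \<open>\<mu>\<close> is a Dirac measure. As \<open>D\<close> is in general not compact, \<open>eta_star\<close> may be
  \<open>0\<close> although the weights are positive everywhere.
\<close>

definition omega_star ::
  "'a measure \<Rightarrow> ('a \<times> 'a) set \<Rightarrow> (real \<Rightarrow> ('a \<Rightarrow> real) \<Rightarrow> 'a \<times> 'a \<Rightarrow> real) \<Rightarrow> ereal" where
  "omega_star \<mu> D \<omega> =
     (INF t\<in>{0..}. INF p\<in>D. INF f\<in>{f \<in> Linf \<mu>. \<not> (AE x in \<mu>. f x = 0)}. ereal (\<omega> t f p))"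

definition eta_star :: "('a \<times> 'a) set \<Rightarrow> (real \<Rightarrow> 'a \<times> 'a \<Rightarrow> real) \<Rightarrow> real" where
  "eta_star D \<eta> = real_of_ereal (INF t\<in>{0..}. INF p\<in>D. ereal (\<eta> t p))"

definition alpha_star :: "(real \<Rightarrow> real) \<Rightarrow> real \<Rightarrow> real" where
  "alpha_star \<alpha> R = (INF y\<in>{0..R}. deriv \<alpha> y)"

end

theory Submission
  imports Defs
begin

text \<open>
  Along the flow of a point \<open>x\<close> at which \<open>r\<close> exceeds a level \<open>\<phi>\<close>, mass can only flow in from points
  with values in \<open>[r x, sup r]\<close>, so the inflow is at most a constant times the excess of \<open>sup r\<close>
  over \<open>\<phi>\<close>. A Gronwall argument for the supremum of the excess then shows that \<open>r\<close> stays below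
  \<open>\<phi>\<close> as soon as \<open>\<phi>'\<close> dominates the outflow. With \<open>\<phi>\<close> constant this is the first claim; for the
  second one, \<open>\<alpha>' \<ge> A\<close>, \<open>\<eta> \<ge> E\<close> and conservation of mass bound the outflow from below by
  \<open>A E r (r - M)\<close>, and \<open>\<phi>\<close> is the solution of the logistic equation \<open>\<phi>' = - A E \<phi> (\<phi> - M)\<close> with
  \<open>\<phi> 0\<close> the norm of \<open>r0\<close>. The same Gronwall argument, applied to \<open>- r\<close>, gives nonnegativity.
\<close>

section \<open>Comparison for integral inequalities\<close>

text \<open>\<open>u\<close> is its initial value plus an indefinite integral. The intermediate
  value argument in \<open>barrier\<close> rests on this continuity.\<close>

lemma continuous_on_if_has_integral_increment:
  fixes f u :: "real \<Rightarrow> real"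
  assumes int: "\<And>s t. 0 \<le> s \<Longrightarrow> s \<le> t \<Longrightarrow> t \<le> T \<Longrightarrow> (f has_integral (u t - u s)) {s..t}"
    and T: "0 \<le> T"
  shows "continuous_on {0..T} u"
proof -
  have "u s = u 0 + integral {0..s} f" if "s \<in> {0..T}" for s
    using integral_unique[OF int[of 0 s]] that by simp
  moreover have "continuous_on {0..T} (\<lambda>s. u 0 + integral {0..s} f)"
    using int[of 0 T] T by (intro continuous_intros indefinite_integral_continuous_1) auto
  ultimately show ?thesis
    by (metis (no_types, lifting) continuous_on_cong)
qed

text \<open>If \<open>u t > 0\<close>, let \<open>t0\<close> be the last zero of \<open>u\<close>
  before \<open>t\<close>. On \<open>[t0, t]\<close> the function \<open>u\<close> is nonnegative,
  so \<open>g \<le> c\<close> there, and integrating from \<open>t0\<close> gives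
  \<open>u t \<le> C t - C t0 \<le> C t\<close>.\<close>

lemma barrier:
  fixes u g :: "real \<Rightarrow> real"
  assumes int: "\<And>s t. 0 \<le> s \<Longrightarrow> s \<le> t \<Longrightarrow> t \<le> T \<Longrightarrow> (g has_integral (u t - u s)) {s..t}"
    and cint: "\<And>s t. 0 \<le> s \<Longrightarrow> s \<le> t \<Longrightarrow> t \<le> T \<Longrightarrow> (c has_integral (C t - C s)) {s..t}"
    and u0: "u 0 \<le> 0" and C0: "0 \<le> C 0"
    and c: "\<And>s. 0 \<le> s \<Longrightarrow> s \<le> T \<Longrightarrow> 0 \<le> c s"
    and le: "\<And>s. 0 \<le> s \<Longrightarrow> s \<le> T \<Longrightarrow> 0 \<le> u s \<Longrightarrow> g s \<le> c s"
    and t: "0 \<le> t" "t \<le> T"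
  shows "u t \<le> C t"
proof -
  have C_nonneg: "0 \<le> C s" if s: "0 \<le> s" "s \<le> T" for s
    using has_integral_nonneg[OF cint[of 0 s]] s c C0 by force
  show ?thesis
  proof (cases "u t \<le> 0")
    case True
    then show ?thesis using C_nonneg[of t] t by simp
  next
    case False
    have cont: "continuous_on {0..t} u"
      using int t by (intro continuous_on_if_has_integral_increment[of t g]) auto
    define Z where "Z = {s \<in> {0..t}. u s = 0}"
    have "compact Z"
      unfolding Z_def compact_eq_bounded_closed
      using continuous_closed_preimage_constant[OF cont, of 0]
      by (auto intro: bounded_subset[of "{0..t}"])
    moreover have "Z \<noteq> {}"
      using IVT'[of u 0 0 t] u0 False t cont by (auto simp: Z_def)
    ultimately obtain t0 where t0: "t0 \<in> Z" "\<And>s. s \<in> Z \<Longrightarrow> s \<le> t0"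
      using compact_attains_sup by metis
    \<comment> \<open>A negative value at \<open>s\<close> would produce a zero in
      \<open>[s, t]\<close>; maximality of \<open>t0\<close> then leaves only \<open>s = t0\<close>,
      where \<open>u\<close> vanishes.\<close>
    have pos: "0 \<le> u s" if s: "s \<in> {t0..t}" for s
    proof (rule ccontr)
      assume neg: "\<not> 0 \<le> u s"
      have "continuous_on {s..t} u"
        using cont by (rule continuous_on_subset) (use s t0 in \<open>auto simp: Z_def\<close>)
      then obtain z where "s \<le> z" "z \<le> t" "u z = 0"
        using IVT'[of u s 0 t] neg False s by auto
      then have "z \<le> t0"
        using s t0 by (auto simp: Z_def)
      with \<open>s \<le> z\<close> s have "s = t0" by simp
      with t0 have "u s = 0" by (simp add: Z_def)
      with neg show False by simp
    qed
    have t0': "0 \<le> t0" "t0 \<le> t" "u t0 = 0"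
      using t0 by (auto simp: Z_def)
    have "u t - u t0 \<le> C t - C t0"
      by (rule has_integral_le[OF int[OF t0'(1,2) t(2)] cint[OF t0'(1,2) t(2)]])
        (use t0' t pos le in auto)
    then show ?thesis
      using C_nonneg[of t0] t0' t by simp
  qed
qed

text \<open>Iterating the hypothesis improves a constant bound to \<open>B (C t)^n / n!\<close> for every \<open>n\<close>, so that the supremum
  over \<open>G\<close> need not be measurable in time.\<close>

lemma sup_barrier:
  fixes u g :: "real \<Rightarrow> 'a \<Rightarrow> real"
  assumes int: "\<And>x s t. x \<in> G \<Longrightarrow> 0 \<le> s \<Longrightarrow> s \<le> t \<Longrightarrow> t \<le> T \<Longrightarrow>
      ((\<lambda>\<tau>. g \<tau> x) has_integral (u t x - u s x)) {s..t}"
    and u0: "\<And>x. x \<in> G \<Longrightarrow> u 0 x \<le> 0"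
    and bdd: "\<And>t x. x \<in> G \<Longrightarrow> 0 \<le> t \<Longrightarrow> t \<le> T \<Longrightarrow> u t x \<le> B"
    and C: "0 \<le> C"
    and le: "\<And>s x b. x \<in> G \<Longrightarrow> 0 \<le> s \<Longrightarrow> s \<le> T \<Longrightarrow> 0 \<le> b \<Longrightarrow> (\<And>y. y \<in> G \<Longrightarrow> u s y \<le> b) \<Longrightarrow>
      0 \<le> u s x \<Longrightarrow> g s x \<le> C * b"
    and t: "0 \<le> t" "t \<le> T" and x: "x \<in> G"
  shows "u t x \<le> 0"
proof -
  \<comment> \<open>\<open>\<beta> (Suc n)\<close> is the primitive of \<open>C * \<beta> n\<close>
    that vanishes at \<open>0\<close>. The constant is \<open>max B 0\<close> because the levels
    \<open>b\<close> in \<open>le\<close> must be nonnegative.\<close>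
  define \<beta> where "\<beta> n s = max B 0 * ((C * s) ^ n / fact n)" for n :: nat and s
  have der: "(\<beta> (Suc n) has_real_derivative C * \<beta> n s) (at s within S)" for n s S
  proof -
    have "((\<lambda>s. (C * s) ^ Suc n) has_real_derivative (1 + real n) * (C * s) ^ n * C) (at s within S)"
      by (rule derivative_eq_intros refl | simp)+
    then have "(\<beta> (Suc n) has_real_derivative
        max B 0 * ((1 + real n) * (C * s) ^ n * C / fact (Suc n))) (at s within S)"
      unfolding \<beta>_def by (intro DERIV_cmult DERIV_cdivide)
    moreover have "max B 0 * ((1 + real n) * (C * s) ^ n * C / fact (Suc n)) = C * \<beta> n s"
      unfolding \<beta>_def fact_Suc of_nat_Suc by (simp add: divide_simps)
    ultimately show ?thesis by simp
  qed
  have "u t x \<le> \<beta> n t" for n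
    using t x
  proof (induction n arbitrary: t x)
    case 0
    then show ?case using bdd[of x t] by (simp add: \<beta>_def max_def)
  next
    case (Suc n)
    \<comment> \<open>\<open>le\<close> needs the bound of the previous stage at all points of
      \<open>G\<close> simultaneously; this is why the induction generalises over \<open>x\<close>
      and \<open>t\<close>.\<close>
    show ?case
    proof (rule barrier[where u = "\<lambda>t. u t x" and g = "\<lambda>t. g t x" and T = T and c = "\<lambda>s. C * \<beta> n s"])
      show "((\<lambda>s. C * \<beta> n s) has_integral \<beta> (Suc n) t - \<beta> (Suc n) s) {s..t}" if "s \<le> t" for s t
        using that der by (intro fundamental_theorem_of_calculus)
          (auto simp: has_real_derivative_iff_has_vector_derivative[symmetric])
      show "0 \<le> C * \<beta> n s" if "0 \<le> s" for s
        using C that by (simp add: \<beta>_def)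
      then show "g s x \<le> C * \<beta> n s" if "0 \<le> s" "s \<le> T" "0 \<le> u s x" for s
        using le[of x s "\<beta> n s"] Suc that C by (simp add: \<beta>_def)
    qed (use Suc.prems int u0 in \<open>auto simp: \<beta>_def\<close>)
  qed
  moreover have "(\<lambda>n. \<beta> n t) \<longlonglongrightarrow> max B 0 * 0"
    unfolding \<beta>_def using summable_LIMSEQ_zero[OF summable_exp[of "C * t"]]
    by (intro tendsto_mult) (auto simp: field_simps)
  ultimately show ?thesis
    by (intro LIMSEQ_le_const[of "\<lambda>n. \<beta> n t" 0]) auto
qed

text \<open>The difference quotients at \<open>s\<close> are at most
  \<open>\<bar>C\<bar> * \<bar>t - s\<bar>\<close>, so \<open>m\<close> has derivative
  \<open>0\<close> throughout \<open>{a..b}\<close>, one-sided at the end points.\<close>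

lemma constant_if_quadratic_increments:
  fixes m :: "real \<Rightarrow> real"
  assumes "\<And>s t. a \<le> s \<Longrightarrow> s \<le> t \<Longrightarrow> t \<le> b \<Longrightarrow> \<bar>m t - m s\<bar> \<le> C * (t - s)\<^sup>2"
    and "a \<le> b"
  shows "m b = m a"
proof -
  have *: "\<bar>m t - m s\<bar> \<le> \<bar>C\<bar> * (t - s)\<^sup>2" if "s \<in> {a..b}" "t \<in> {a..b}" for s t
  proof -
    have "C * z\<^sup>2 \<le> \<bar>C\<bar> * z\<^sup>2" for z by (intro mult_right_mono) auto
    then show ?thesis
      using assms(1)[of s t] assms(1)[of t s] that
      by (cases "s \<le> t") (force simp: power2_commute abs_minus_commute intro: order_trans)+
  qed
  have "(m has_real_derivative 0) (at s within {a..b})" if s: "s \<in> {a..b}" for s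
    unfolding has_field_derivative_iff
  proof (rule Lim_null_comparison)
    show "\<forall>\<^sub>F t in at s within {a..b}. norm ((m t - m s) / (t - s)) \<le> \<bar>C\<bar> * \<bar>t - s\<bar>"
      unfolding eventually_at_filter
    proof (intro always_eventually allI impI)
      fix t assume "t \<noteq> s" "t \<in> {a..b}"
      then show "norm ((m t - m s) / (t - s)) \<le> \<bar>C\<bar> * \<bar>t - s\<bar>"
        using *[OF s \<open>t \<in> {a..b}\<close>] by (simp add: divide_simps power2_eq_square abs_mult_self_eq mult.assoc)
    qed
    show "((\<lambda>t. \<bar>C\<bar> * \<bar>t - s\<bar>) \<longlongrightarrow> 0) (at s within {a..b})"
      by (auto intro!: tendsto_eq_intros)
  qed
  then show ?thesis
    using has_field_derivative_zero_constant[of "{a..b}" m] assms(2) by fastforce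
qed

section \<open>The nonlocal upwind flow\<close>

text \<open>At most one of the two upwind terms is nonzero, whence the factor \<open>R\<close>
  rather than \<open>2 * R\<close>.\<close>

lemma abs_Phi_upwind_le:
  assumes "\<bar>a\<bar> \<le> R" "\<bar>b\<bar> \<le> R"
  shows "\<bar>Phi_upwind a b w\<bar> \<le> R * \<bar>w\<bar>"
proof (cases "0 \<le> w")
  case True
  then show ?thesis
    using assms by (auto simp: Phi_upwind_def abs_mult intro: mult_right_mono)
next
  case False
  then show ?thesis
    using assms by (auto simp: Phi_upwind_def abs_mult intro: mult_right_mono)
qed

text \<open>A discrete product rule: \<open>max w 0\<close> and \<open>max (- w) 0\<close> are
  bounded by \<open>\<bar>w\<bar>\<close> and Lipschitz in \<open>w\<close> with constant
  \<open>1\<close>.\<close>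

lemma abs_Phi_upwind_diff_le:
  "\<bar>Phi_upwind a b w - Phi_upwind a' b' w'\<bar> \<le>
    (\<bar>a - a'\<bar> + \<bar>b - b'\<bar>) * \<bar>w\<bar> + (\<bar>a'\<bar> + \<bar>b'\<bar>) * \<bar>w - w'\<bar>"
proof -
  have "Phi_upwind a b w - Phi_upwind a' b' w' =
      ((a - a') * max w 0 + a' * (max w 0 - max w' 0)) -
      ((b - b') * max (- w) 0 + b' * (max (- w) 0 - max (- w') 0))"
    by (simp add: Phi_upwind_def algebra_simps)
  also have "\<bar>\<dots>\<bar> \<le> (\<bar>a - a'\<bar> * \<bar>max w 0\<bar> + \<bar>a'\<bar> * \<bar>max w 0 - max w' 0\<bar>) +
      (\<bar>b - b'\<bar> * \<bar>max (- w) 0\<bar> + \<bar>b'\<bar> * \<bar>max (- w) 0 - max (- w') 0\<bar>)"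
    unfolding abs_mult[symmetric]
    by (rule order_trans[OF abs_triangle_ineq4]) (intro add_mono abs_triangle_ineq)
  also have "\<dots> \<le> (\<bar>a - a'\<bar> * \<bar>w\<bar> + \<bar>a'\<bar> * \<bar>w - w'\<bar>) + (\<bar>b - b'\<bar> * \<bar>w\<bar> + \<bar>b'\<bar> * \<bar>w - w'\<bar>)"
    by (intro add_mono mult_left_mono) auto
  finally show ?thesis by (simp add: algebra_simps)
qed

text \<open>Together with the symmetry of the weights, this antisymmetry is the source of the
  conservation of mass.\<close>

lemma Phi_upwind_swap: "Phi_upwind b a (- w) = - Phi_upwind a b w"
  by (simp add: Phi_upwind_def)

lemma borel_measurable_Phi_upwind [measurable]:
  assumes [measurable]: "f \<in> borel_measurable M" "g \<in> borel_measurable M" "h \<in> borel_measurable M"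
  shows "(\<lambda>x. Phi_upwind (f x) (g x) (h x)) \<in> borel_measurable M"
  unfolding Phi_upwind_def by measurable

lemma (in prob_space) abs_integral_le_const:
  fixes f :: "'a \<Rightarrow> real"
  assumes "integrable M f" "AE x in M. \<bar>f x\<bar> \<le> c"
  shows "\<bar>integral\<^sup>L M f\<bar> \<le> c"
  by (rule order_trans[OF integral_abs_bound integral_le_const]) (use assms in auto)

lemma has_integral_abs_le:
  fixes f :: "real \<Rightarrow> real"
  assumes "(f has_integral i) {a..b}" "a \<le> b" "\<And>x. a \<le> x \<Longrightarrow> x \<le> b \<Longrightarrow> \<bar>f x\<bar> \<le> c"
  shows "\<bar>i\<bar> \<le> c * (b - a)"
proof -
  have "0 \<le> c" using assms(2) assms(3)[of a] by linarith
  then show ?thesis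
    using has_integral_bound_real[of c "{}" f i a b] assms by auto
qed

text \<open>The flow on a fixed time horizon, with all bounds valid at every point of a set
  \<open>G\<close> of full measure that does not depend on time, as \<open>sup_barrier\<close>
  requires. The kernel \<open>k\<close> stands for the weights, extended to all pairs so that the
  flux is an integral over the whole space.\<close>

locale upwind_flow = prob_space \<mu> for \<mu> :: "'a measure" +
  fixes G :: "'a set" and \<alpha> :: "real \<Rightarrow> real" and k :: "real \<Rightarrow> 'a \<Rightarrow> 'a \<Rightarrow> real"
    and r :: "real \<Rightarrow> 'a \<Rightarrow> real" and T L H N R :: real
  assumes G_subset: "G \<subseteq> space \<mu>"
    and AE_G: "AE x in \<mu>. x \<in> G"
    and alpha_mono: "mono \<alpha>"
    and alpha_Lipschitz: "\<bar>\<alpha> a - \<alpha> b\<bar> \<le> L * \<bar>a - b\<bar>"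
    and k_measurable [measurable]:
      "0 \<le> t \<Longrightarrow> t \<le> T \<Longrightarrow> (\<lambda>p. k t (fst p) (snd p)) \<in> borel_measurable (\<mu> \<Otimes>\<^sub>M \<mu>)"
    and k_sym: "0 \<le> t \<Longrightarrow> t \<le> T \<Longrightarrow> k t x y = k t y x"
    and k_nonneg: "0 \<le> t \<Longrightarrow> t \<le> T \<Longrightarrow> 0 \<le> k t x y"
    and k_le: "0 \<le> t \<Longrightarrow> t \<le> T \<Longrightarrow> k t x y \<le> H"
    and k_Lipschitz: "0 \<le> s \<Longrightarrow> s \<le> t \<Longrightarrow> t \<le> T \<Longrightarrow> \<bar>k t x y - k s x y\<bar> \<le> N * (t - s)"
    and r_measurable [measurable]: "0 \<le> t \<Longrightarrow> t \<le> T \<Longrightarrow> r t \<in> borel_measurable \<mu>"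
    and r_bound: "x \<in> G \<Longrightarrow> 0 \<le> t \<Longrightarrow> t \<le> T \<Longrightarrow> \<bar>r t x\<bar> \<le> R"
    and r_flux: "x \<in> G \<Longrightarrow> 0 \<le> s \<Longrightarrow> s \<le> t \<Longrightarrow> t \<le> T \<Longrightarrow>
      ((\<lambda>\<tau>. LINT y|\<mu>. Phi_upwind (r \<tau> x) (r \<tau> y) (\<alpha> (r \<tau> x) - \<alpha> (r \<tau> y)) * k \<tau> x y)
        has_integral (r s x - r t x)) {s..t}"
    and constants_nonneg: "0 \<le> T" "0 \<le> N" "0 \<le> R"
begin

text \<open>The net flow from \<open>x\<close> towards \<open>y\<close>: the value of
  \<open>r\<close> at \<open>x\<close> decreases at the rate given by the integral of
  \<open>density t x\<close>.\<close>

definition density :: "real \<Rightarrow> 'a \<Rightarrow> 'a \<Rightarrow> real" where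
  "density t x y = Phi_upwind (r t x) (r t y) (\<alpha> (r t x) - \<alpha> (r t y)) * k t x y"

definition flux :: "real \<Rightarrow> 'a \<Rightarrow> real" where
  "flux t x = (LINT y|\<mu>. density t x y)"

section \<open>Bounds on the flow and its Lipschitz continuity in time\<close>

lemma L_nonneg: "0 \<le> L"
  using order_trans[OF abs_ge_zero alpha_Lipschitz[of 1 0]] by simp

text \<open>\<open>undefined\<close> serves as an arbitrary point, the bounds on \<open>k\<close>
  being valid for all pairs.\<close>

lemma H_nonneg: "0 \<le> H"
  using k_nonneg[of 0 undefined undefined] k_le[of 0 undefined undefined] constants_nonneg by linarith

lemma r_has_integral:
  assumes "x \<in> G" "0 \<le> s" "s \<le> t" "t \<le> T"
  shows "((\<lambda>\<tau>. flux \<tau> x) has_integral (r s x - r t x)) {s..t}"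
  using r_flux[OF assms] by (simp add: flux_def density_def)

lemma alpha_measurable [measurable]: "\<alpha> \<in> borel_measurable borel"
  using alpha_mono by (rule borel_measurable_mono)

lemma density_measurable [measurable]:
  assumes [simp]: "0 \<le> t" "t \<le> T"
  shows "(\<lambda>p. density t (fst p) (snd p)) \<in> borel_measurable (\<mu> \<Otimes>\<^sub>M \<mu>)"
  unfolding density_def by measurable

lemma density_measurable_snd [measurable]:
  assumes "0 \<le> t" "t \<le> T" "x \<in> space \<mu>"
  shows "density t x \<in> borel_measurable \<mu>"
  using measurable_compose[OF measurable_Pair1'[OF assms(3)] density_measurable[OF assms(1,2)]]
  by simp

lemma alpha_diff_bound:
  assumes "x \<in> G" "y \<in> G" "0 \<le> t" "t \<le> T"
  shows "\<bar>\<alpha> (r t x) - \<alpha> (r t y)\<bar> \<le> L * (2 * R)"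
  by (rule order_trans[OF alpha_Lipschitz mult_left_mono[OF _ L_nonneg]])
    (use r_bound[OF assms(1,3,4)] r_bound[OF assms(2,3,4)] in linarith)

lemma Phi_bound:
  assumes "x \<in> G" "y \<in> G" "0 \<le> t" "t \<le> T"
  shows "\<bar>Phi_upwind (r t x) (r t y) (\<alpha> (r t x) - \<alpha> (r t y))\<bar> \<le> R * (L * (2 * R))"
  by (rule order_trans[OF abs_Phi_upwind_le mult_left_mono])
    (use assms r_bound alpha_diff_bound constants_nonneg in auto)

text \<open>A bound for \<open>density\<close>: \<open>R\<close> for the values of \<open>r\<close>,
  \<open>L * (2 * R)\<close> for the velocity and \<open>H\<close> for the weight. As \<mu> is a
  probability measure, \<open>F\<close> also bounds the flux and is thus a Lipschitz constant of
  \<open>r\<close> in time.\<close>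

definition "F = R * (L * (2 * R)) * H"

lemma F_nonneg: "0 \<le> F"
  using L_nonneg H_nonneg constants_nonneg by (simp add: F_def)

lemma density_bound:
  assumes "x \<in> G" "y \<in> G" "0 \<le> t" "t \<le> T"
  shows "\<bar>density t x y\<bar> \<le> F"
  unfolding density_def F_def abs_mult
  using Phi_bound[OF assms] k_nonneg k_le assms L_nonneg constants_nonneg
  by (intro mult_mono) auto

lemma density_integrable:
  assumes "x \<in> G" "0 \<le> t" "t \<le> T"
  shows "integrable \<mu> (density t x)"
  using AE_G density_bound[OF assms(1) _ assms(2,3)] density_measurable_snd[OF assms(2,3), of x]
    assms(1) G_subset
  by (intro integrable_const_bound[of _ F]) auto

lemma density_swap:
  assumes "0 \<le> t" "t \<le> T"
  shows "density t x y = - density t y x"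
  using k_sym[OF assms, of x y] Phi_upwind_swap[of "r t x" "r t y" "\<alpha> (r t y) - \<alpha> (r t x)"]
  by (simp add: density_def)

lemma flux_le:
  assumes "x \<in> G" "0 \<le> t" "t \<le> T" "\<And>y. y \<in> G \<Longrightarrow> density t x y \<le> c"
  shows "flux t x \<le> c"
  unfolding flux_def using AE_G assms density_integrable by (intro integral_le_const) auto

lemma flux_bound:
  assumes "x \<in> G" "0 \<le> t" "t \<le> T"
  shows "\<bar>flux t x\<bar> \<le> F"
  unfolding flux_def using AE_G assms density_integrable density_bound
  by (intro abs_integral_le_const) auto

lemma r_Lipschitz:
  assumes "x \<in> G" "0 \<le> s" "s \<le> t" "t \<le> T"
  shows "\<bar>r t x - r s x\<bar> \<le> F * (t - s)"
  using has_integral_abs_le[OF r_has_integral[OF assms], of F] flux_bound assms by force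

text \<open>The Lipschitz constant of \<open>density\<close> in time, by the product rule:
  \<open>r\<close> varies at rate at most \<open>F\<close>, the velocity at most
  \<open>L * (F + F)\<close> and the weight at most \<open>N\<close>.\<close>

definition "Q = ((F + F) * (L * (2 * R)) + (R + R) * (L * (F + F))) * H + R * (L * (2 * R)) * N"

lemma density_Lipschitz:
  assumes "x \<in> G" "y \<in> G" "0 \<le> s" "s \<le> t" "t \<le> T"
  shows "\<bar>density t x y - density s x y\<bar> \<le> Q * (t - s)"
proof -
  let ?w = "\<lambda>t. \<alpha> (r t x) - \<alpha> (r t y)"
  let ?P = "\<lambda>t. Phi_upwind (r t x) (r t y) (?w t)"
  note rx = r_Lipschitz[OF assms(1,3-5)] and ry = r_Lipschitz[OF assms(2-5)]
  have d: "0 \<le> t - s" and t: "0 \<le> t" "s \<le> T" using assms by auto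
  have "\<bar>?w t - ?w s\<bar> \<le> \<bar>\<alpha> (r t x) - \<alpha> (r s x)\<bar> + \<bar>\<alpha> (r t y) - \<alpha> (r s y)\<bar>"
    by linarith
  also have "\<dots> \<le> L * (F * (t - s)) + L * (F * (t - s))"
    by (intro add_mono order_trans[OF alpha_Lipschitz] mult_left_mono rx ry L_nonneg)
  finally have w: "\<bar>?w t - ?w s\<bar> \<le> L * (F + F) * (t - s)" by (simp add: algebra_simps)
  have "\<bar>?P t - ?P s\<bar> \<le> (F * (t - s) + F * (t - s)) * (L * (2 * R)) + (R + R) * (L * (F + F) * (t - s))"
    by (intro order_trans[OF abs_Phi_upwind_diff_le] add_mono mult_mono rx ry w
        alpha_diff_bound r_bound add_nonneg_nonneg mult_nonneg_nonneg)
      (use assms t d F_nonneg L_nonneg constants_nonneg in auto)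
  also have "\<dots> = ((F + F) * (L * (2 * R)) + (R + R) * (L * (F + F))) * (t - s)"
    by (simp add: algebra_simps)
  finally have P: "\<bar>?P t - ?P s\<bar> \<le> \<dots>" .
  have "density t x y - density s x y = (?P t - ?P s) * k t x y + ?P s * (k t x y - k s x y)"
    by (simp add: density_def algebra_simps)
  also have "\<bar>\<dots>\<bar> \<le> \<bar>?P t - ?P s\<bar> * \<bar>k t x y\<bar> + \<bar>?P s\<bar> * \<bar>k t x y - k s x y\<bar>"
    unfolding abs_mult[symmetric] by linarith
  also have "\<dots> \<le> ((F + F) * (L * (2 * R)) + (R + R) * (L * (F + F))) * (t - s) * H +
      R * (L * (2 * R)) * (N * (t - s))"
    using k_nonneg[of t x y] k_le[of t x y] assms t d F_nonneg L_nonneg constants_nonneg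
    by (intro add_mono mult_mono P Phi_bound k_Lipschitz) auto
  also have "\<dots> = Q * (t - s)"
    by (simp add: Q_def algebra_simps)
  finally show ?thesis .
qed

lemma flux_Lipschitz:
  assumes "x \<in> G" "0 \<le> s" "s \<le> t" "t \<le> T"
  shows "\<bar>flux t x - flux s x\<bar> \<le> Q * (t - s)"
proof -
  have int: "integrable \<mu> (density t x)" "integrable \<mu> (density s x)"
    using assms by (auto intro: density_integrable)
  then have "flux t x - flux s x = (LINT y|\<mu>. density t x y - density s x y)"
    by (simp add: flux_def)
  also have "\<bar>\<dots>\<bar> \<le> Q * (t - s)"
    using int AE_G density_Lipschitz assms by (intro abs_integral_le_const) auto
  finally show ?thesis .
qed

section \<open>Zero mean of the flux and conservation of mass\<close>

lemma flux_measurable [measurable]: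
  assumes "0 \<le> t" "t \<le> T"
  shows "flux t \<in> borel_measurable \<mu>"
  unfolding flux_def
  using borel_measurable_lebesgue_integral[of "density t" \<mu>] density_measurable[OF assms]
  by (simp add: case_prod_beta')

lemma flux_integrable:
  assumes "0 \<le> t" "t \<le> T"
  shows "integrable \<mu> (flux t)"
  using AE_G flux_bound[OF _ assms] flux_measurable[OF assms]
  by (intro integrable_const_bound[of _ F]) auto

lemma r_integrable:
  assumes "0 \<le> t" "t \<le> T"
  shows "integrable \<mu> (r t)"
  using AE_G r_bound[OF _ assms] r_measurable[OF assms]
  by (intro integrable_const_bound[of _ R]) auto

text \<open>\<open>density\<close> is antisymmetric in the two points and integrable on the product,
  so Fubini's theorem equates its double integral with the negative of itself.\<close>

lemma integral_flux_eq_0: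
  assumes t: "0 \<le> t" "t \<le> T"
  shows "(LINT x|\<mu>. flux t x) = 0"
proof -
  have norm_meas: "(\<lambda>x. LINT y|\<mu>. \<bar>density t x y\<bar>) \<in> borel_measurable \<mu>"
    using borel_measurable_lebesgue_integral[of "\<lambda>x y. \<bar>density t x y\<bar>" \<mu>]
      density_measurable[OF t] by (simp add: case_prod_beta')
  interpret pair_sigma_finite \<mu> \<mu> ..
  let ?f = "case_prod (density t)"
  have meas: "?f \<in> borel_measurable (\<mu> \<Otimes>\<^sub>M \<mu>)"
    using density_measurable[OF t] by (simp add: case_prod_beta')
  have int: "integrable (\<mu> \<Otimes>\<^sub>M \<mu>) ?f"
  proof (rule Fubini_integrable[OF meas])
    show "AE x in \<mu>. integrable \<mu> (\<lambda>y. ?f (x, y))"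
      using AE_G density_integrable[OF _ t] by auto
    have "\<bar>LINT y|\<mu>. \<bar>density t x y\<bar>\<bar> \<le> F" if "x \<in> G" for x
      using AE_G density_integrable[OF that t] density_bound[OF that _ t]
      by (intro abs_integral_le_const) auto
    with norm_meas show "integrable \<mu> (\<lambda>x. LINT y|\<mu>. norm (?f (x, y)))"
      using AE_G by (intro integrable_const_bound[of _ F]) auto
  qed
  have "(LINT x|\<mu>. flux t x) = (LINT y|\<mu>. LINT x|\<mu>. density t x y)"
    unfolding flux_def using Fubini_integral[OF int] by simp
  also have "\<dots> = (LINT y|\<mu>. LINT x|\<mu>. - density t y x)"
    by (subst density_swap[OF t]) (rule refl)
  also have "(LINT y|\<mu>. LINT x|\<mu>. - density t y x) = - (LINT x|\<mu>. flux t x)"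
    by (simp add: flux_def)
  finally show ?thesis by simp
qed

text \<open>Since the flux is Lipschitz in time uniformly on \<open>G\<close>, the mass increments are quadratically
  small; this replaces an application of Fubini's theorem in space and time.\<close>

lemma mass_conserved:
  assumes t: "0 \<le> t" "t \<le> T"
  shows "(LINT x|\<mu>. r t x) = (LINT x|\<mu>. r 0 x)"
proof (rule constant_if_quadratic_increments[OF _ t(1)])
  fix s u assume su: "0 \<le> s" "s \<le> u" "u \<le> t"
  then have T: "u \<le> T" "0 \<le> u" "s \<le> T" using t by auto
  \<comment> \<open>This is the first-order Taylor remainder at time \<open>s\<close>. As
    \<open>flux s\<close> has zero integral, the correction \<open>(u - s) * flux s\<close> leaves
    the mass increment unchanged.\<close>
  have *: "\<bar>r u x - r s x + (u - s) * flux s x\<bar> \<le> Q * (u - s)\<^sup>2" if x: "x \<in> G" for x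
  proof -
    have "((\<lambda>\<tau>. flux \<tau> x - flux s x) has_integral ((r s x - r u x) - (u - s) * flux s x)) {s..u}"
      using r_has_integral[OF x su(1,2) T(1)] has_integral_const_real[of "flux s x" s u] su
      by (intro has_integral_diff) auto
    then have "\<bar>(r s x - r u x) - (u - s) * flux s x\<bar> \<le> (Q * (u - s)) * (u - s)"
    proof (rule has_integral_abs_le)
      fix \<tau> assume \<tau>: "s \<le> \<tau>" "\<tau> \<le> u"
      have "0 \<le> Q" unfolding Q_def using F_nonneg H_nonneg L_nonneg constants_nonneg by auto
      then have "Q * (\<tau> - s) \<le> Q * (u - s)" using \<tau> by (intro mult_left_mono) auto
      with flux_Lipschitz[OF x su(1) \<tau>(1)] \<tau> T
      show "\<bar>flux \<tau> x - flux s x\<bar> \<le> Q * (u - s)" by auto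
    qed (use su in auto)
    then show ?thesis by (simp add: power2_eq_square algebra_simps)
  qed
  have int: "integrable \<mu> (r u)" "integrable \<mu> (r s)" "integrable \<mu> (flux s)"
    using r_integrable flux_integrable su T by auto
  have "(LINT x|\<mu>. r u x) - (LINT x|\<mu>. r s x) =
      (LINT x|\<mu>. r u x - r s x + (u - s) * flux s x)"
    using int integral_flux_eq_0[OF su(1) T(3)] by simp
  also have "\<bar>\<dots>\<bar> \<le> Q * (u - s)\<^sup>2"
    using int AE_G * by (intro abs_integral_le_const) auto
  finally show "\<bar>(LINT x|\<mu>. r u x) - (LINT x|\<mu>. r s x)\<bar> \<le> Q * (u - s)\<^sup>2" .
qed

section \<open>Comparison: nonnegativity and upper bounds\<close>

lemma r_nonneg:
  assumes r0: "\<And>x. x \<in> G \<Longrightarrow> 0 \<le> r 0 x"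
    and x: "x \<in> G" "0 \<le> t" "t \<le> T"
  shows "0 \<le> r t x"
proof -
  have "- r t x \<le> 0"
  proof (rule sup_barrier[where u = "\<lambda>t x. - r t x" and g = flux and G = G and T = T and B = R
        and C = "L * (2 * R) * H"])
    show "0 \<le> L * (2 * R) * H"
      using L_nonneg H_nonneg constants_nonneg by auto
    show "- r s x \<le> R" if "x \<in> G" "0 \<le> s" "s \<le> T" for s x
      using r_bound[OF that] by linarith
  next
    fix s x b
    assume x: "x \<in> G" "0 \<le> s" "s \<le> T" "0 \<le> - r s x"
      and b: "0 \<le> b" "\<And>y. y \<in> G \<Longrightarrow> - r s y \<le> b"
    show "flux s x \<le> L * (2 * R) * H * b"
    proof (rule flux_le[OF x(1-3)])
      fix y assume y: "y \<in> G"
      let ?w = "\<alpha> (r s x) - \<alpha> (r s y)"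
      \<comment> \<open>Where \<open>r \<le> 0\<close>, the outflow term has a favourable sign. The
        inflow term is small because \<open>- r s y \<le> b\<close>, while the velocity is only
        bounded by \<open>L * (2 * R)\<close>.\<close>
      have "r s x * max ?w 0 \<le> 0"
        using x by (intro mult_nonpos_nonneg) auto
      moreover have "- r s y * max (- ?w) 0 \<le> b * (L * (2 * R))"
        using b y alpha_diff_bound[OF x(1) y x(2,3)] by (intro mult_mono) auto
      ultimately have "Phi_upwind (r s x) (r s y) ?w \<le> b * (L * (2 * R))"
        by (simp add: Phi_upwind_def)
      then have "density s x y \<le> (b * (L * (2 * R))) * k s x y"
        unfolding density_def using k_nonneg[OF x(2,3)] by (intro mult_right_mono)
      also have "\<dots> \<le> (b * (L * (2 * R))) * H"
        using k_le[OF x(2,3)] b L_nonneg constants_nonneg by (intro mult_left_mono) auto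
      finally show "density s x y \<le> L * (2 * R) * H * b" by (simp add: mult_ac)
    qed
  qed (use assms r_has_integral in auto)
  then show ?thesis by simp
qed

text \<open>Where \<open>r s x \<ge> \<phi> s\<close>, inflow comes only from points with
  \<open>r s y \<ge> r s x\<close>; the velocity there is at most \<open>L * b\<close>, which yields
  the constant \<open>R * L * H\<close>. The bound \<open>drift\<close> covers all \<open>y\<close>,
  also those where its left-hand side is negative, so that averaging over \<open>y\<close> turns
  \<open>r s x - r s y\<close> into \<open>r s x - M\<close> by conservation of mass.\<close>

lemma r_le_supersolution:
  fixes \<phi> \<phi>' :: "real \<Rightarrow> real"
  defines "M \<equiv> LINT x|\<mu>. r 0 x"
  assumes r0: "\<And>x. x \<in> G \<Longrightarrow> 0 \<le> r 0 x" "\<And>x. x \<in> G \<Longrightarrow> r 0 x \<le> \<phi> 0"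
    and c: "0 \<le> c"
    and drift: "\<And>s x y. 0 \<le> s \<Longrightarrow> s \<le> T \<Longrightarrow> x \<in> G \<Longrightarrow> y \<in> G \<Longrightarrow>
      c * (r s x - r s y) \<le> max (\<alpha> (r s x) - \<alpha> (r s y)) 0 * k s x y"
    and \<phi>_deriv: "\<And>s. 0 \<le> s \<Longrightarrow> s \<le> T \<Longrightarrow> (\<phi> has_real_derivative \<phi>' s) (at s)"
    and \<phi>': "\<And>s. 0 \<le> s \<Longrightarrow> s \<le> T \<Longrightarrow> - c * \<phi> s * (\<phi> s - M) \<le> \<phi>' s"
    and \<phi>_ge: "\<And>s. 0 \<le> s \<Longrightarrow> s \<le> T \<Longrightarrow> M \<le> \<phi> s"
    and x: "x \<in> G" "0 \<le> t" "t \<le> T"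
  shows "r t x \<le> \<phi> t"
proof -
  have M: "0 \<le> M"
    unfolding M_def using AE_G r0 by (intro integral_nonneg_AE) auto
  have "r t x - \<phi> t \<le> 0"
  proof (rule sup_barrier[where u = "\<lambda>t x. r t x - \<phi> t" and g = "\<lambda>s x. - flux s x - \<phi>' s"
        and G = G and T = T and B = R and C = "R * L * H"])
    show "0 \<le> R * L * H"
      using L_nonneg H_nonneg constants_nonneg by auto
    show "r s x - \<phi> s \<le> R" if "x \<in> G" "0 \<le> s" "s \<le> T" for s x
      using r_bound[OF that] \<phi>_ge[OF that(2,3)] M by linarith
    show "((\<lambda>\<tau>. - flux \<tau> x - \<phi>' \<tau>) has_integral (r u x - \<phi> u - (r s x - \<phi> s))) {s..u}"
      if "x \<in> G" "0 \<le> s" "s \<le> u" "u \<le> T" for x s u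
    proof -
      have "(\<phi>' has_integral (\<phi> u - \<phi> s)) {s..u}"
        using that \<phi>_deriv by (intro fundamental_theorem_of_calculus)
          (auto simp: has_real_derivative_iff_has_vector_derivative[symmetric]
            intro: has_field_derivative_at_within)
      from has_integral_diff[OF has_integral_neg[OF r_has_integral[OF that]] this]
      show ?thesis by (simp add: algebra_simps)
    qed
  next
    fix s x b
    assume x: "x \<in> G" "0 \<le> s" "s \<le> T" "0 \<le> r s x - \<phi> s"
      and b: "0 \<le> b" "\<And>y. y \<in> G \<Longrightarrow> r s y - \<phi> s \<le> b"
    have rx: "M \<le> r s x" "0 \<le> r s x" using x \<phi>_ge[OF x(2,3)] M by linarith+
    have le: "r s x * c * (r s x - r s y) - R * L * H * b \<le> density s x y" if y: "y \<in> G" for y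
    proof -
      let ?w = "\<alpha> (r s x) - \<alpha> (r s y)"
      have "max (- ?w) 0 \<le> L * b"
      proof (cases "r s x \<le> r s y")
        case True
        then have "L * \<bar>r s y - r s x\<bar> \<le> L * b"
          using b(2)[OF y] x L_nonneg by (intro mult_left_mono) auto
        with alpha_Lipschitz[of "r s y" "r s x"] L_nonneg b show ?thesis by auto
      next
        case False
        then have "0 \<le> ?w" using monoD[OF alpha_mono, of "r s y" "r s x"] by simp
        then show ?thesis using L_nonneg b by simp
      qed
      then have "r s y * max (- ?w) 0 * k s x y \<le> R * (L * b) * H"
        using r_nonneg[OF r0(1) y x(2,3)] r_bound[OF y x(2,3)] k_nonneg[OF x(2,3), of x y]
          k_le[OF x(2,3), of x y] L_nonneg constants_nonneg b
        by (intro mult_mono) auto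
      moreover have "r s x * (c * (r s x - r s y)) \<le> r s x * (max ?w 0 * k s x y)"
        using rx drift[OF x(2,3,1) y] by (intro mult_left_mono) auto
      ultimately show ?thesis
        by (simp add: density_def Phi_upwind_def algebra_simps)
    qed
    have "(LINT y|\<mu>. r s x * c * (r s x - r s y) - R * L * H * b) \<le> flux s x"
      unfolding flux_def using AE_G le r_integrable[OF x(2,3)] density_integrable[OF x(1-3)]
      by (intro integral_mono_AE) auto
    also have "(LINT y|\<mu>. r s x * c * (r s x - r s y) - R * L * H * b) =
        r s x * c * (r s x - M) - R * L * H * b"
      using r_integrable[OF x(2,3)] mass_conserved[OF x(2,3)] by (simp add: M_def prob_space)
    finally have "- flux s x \<le> R * L * H * b - c * (r s x * (r s x - M))"
      by (simp add: algebra_simps)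
    \<comment> \<open>\<open>z * (z - M)\<close> is increasing for \<open>z \<ge> M \<ge> 0\<close>,
      and \<open>M \<le> \<phi> s \<le> r s x\<close>.\<close>
    moreover have "c * (\<phi> s * (\<phi> s - M)) \<le> c * (r s x * (r s x - M))"
      using x \<phi>_ge[OF x(2,3)] M c by (intro mult_left_mono mult_mono) auto
    ultimately show "- flux s x - \<phi>' s \<le> R * L * H * b"
      using \<phi>'[OF x(2,3)] by (simp add: mult.assoc)
  qed (use assms in auto)
  then show ?thesis by simp
qed

end

section \<open>Essentially bounded functions\<close>

lemma AE_abs_le_Linf_norm:
  assumes "f \<in> Linf \<mu>"
  shows "AE x in \<mu>. \<bar>f x\<bar> \<le> Linf_norm \<mu> f"
  using esssup_AE[of "\<lambda>x. ereal \<bar>f x\<bar>" \<mu>]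
proof eventually_elim
  case (elim x)
  with assms show ?case
    by (cases "esssup \<mu> (\<lambda>x. ereal \<bar>f x\<bar>)") (auto simp: Linf_def Linf_norm_def)
qed

lemma LinfI:
  assumes "f \<in> borel_measurable \<mu>" "AE x in \<mu>. \<bar>f x\<bar> \<le> c"
  shows "f \<in> Linf \<mu>"
proof -
  have "esssup \<mu> (\<lambda>x. ereal \<bar>f x\<bar>) \<le> ereal c"
    using assms by (intro esssup_I) auto
  with assms(1) show ?thesis unfolding Linf_def by auto
qed

lemma Linf_diff:
  assumes "f \<in> Linf \<mu>" "g \<in> Linf \<mu>"
  shows "(\<lambda>x. f x - g x) \<in> Linf \<mu>"
proof (rule LinfI)
  show "(\<lambda>x. f x - g x) \<in> borel_measurable \<mu>"
    using assms by (auto simp: Linf_def)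
  show "AE x in \<mu>. \<bar>f x - g x\<bar> \<le> Linf_norm \<mu> f + Linf_norm \<mu> g"
    using assms[THEN AE_abs_le_Linf_norm] by eventually_elim linarith
qed

text \<open>For the null measure the essential supremum is \<open>-\<infinity>\<close>, which
  \<open>real_of_ereal\<close> sends to \<open>0\<close>; hence the assumption
  \<open>0 \<le> c\<close>.\<close>

lemma Linf_norm_le:
  assumes "f \<in> borel_measurable \<mu>" "AE x in \<mu>. \<bar>f x\<bar> \<le> c" "0 \<le> c"
  shows "Linf_norm \<mu> f \<le> c"
proof -
  have "esssup \<mu> (\<lambda>x. ereal \<bar>f x\<bar>) \<le> ereal c"
    using assms by (intro esssup_I) auto
  with assms(3) show ?thesis
    unfolding Linf_norm_def by (cases "esssup \<mu> (\<lambda>x. ereal \<bar>f x\<bar>)") auto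
qed

lemma (in prob_space) Linf_norm_nonneg:
  assumes "f \<in> Linf M"
  shows "0 \<le> Linf_norm M f"
proof -
  have "AE x in M. 0 \<le> Linf_norm M f"
    using AE_abs_le_Linf_norm[OF assms] by eventually_elim linarith
  then show ?thesis by simp
qed

text \<open>The complement of the support is the union of all open null sets, and by the Lindelof
  property countably many of them have the same union.\<close>

lemma AE_in_supp:
  fixes \<mu> :: "'a::second_countable_topology measure"
  assumes "sets \<mu> = sets borel"
  shows "AE x in \<mu>. x \<in> supp \<mu>"
proof -
  obtain \<F> where \<F>: "\<F> \<subseteq> {U. open U \<and> emeasure \<mu> U = 0}" "countable \<F>"
      "\<Union>\<F> = \<Union>{U. open U \<and> emeasure \<mu> U = 0}"
    using Lindelof[of "{U. open U \<and> emeasure \<mu> U = 0}"] by auto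
  have "AE x in \<mu>. \<forall>U\<in>\<F>. x \<notin> U"
    unfolding AE_ball_countable[OF \<F>(2)]
    using \<F>(1) assms by (auto intro!: AE_not_in simp: null_sets_def)
  then show ?thesis
  proof eventually_elim
    case (elim x)
    then have "x \<notin> \<Union>{U. open U \<and> emeasure \<mu> U = 0}"
      unfolding \<F>(3)[symmetric] by blast
    then show ?case
      by (auto simp: supp_def zero_less_iff_neq_zero)
  qed
qed

text \<open>Absolute continuity with \<open>\<epsilon> = 1\<close> and a single interval lets the
  norm grow by at most \<open>1\<close> over a time step of length \<open>\<delta> / 2\<close>, and
  finitely many steps cover \<open>[0, T]\<close>. The null set may depend on \<open>t\<close>, the
  bound does not.\<close>

lemma AC_curve_Linf_bounded:
  assumes AC: "AC_curve (Linf_norm \<mu>) (Linf \<mu>) r" and T: "0 < T"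
  obtains R where "\<And>t. 0 \<le> t \<Longrightarrow> t \<le> T \<Longrightarrow> AE x in \<mu>. \<bar>r t x\<bar> \<le> R"
proof -
  have r: "r t \<in> Linf \<mu>" if "0 \<le> t" for t
    using AC that by (simp add: AC_curve_def)
  note AC[unfolded AC_curve_def, THEN conjunct2, THEN spec[of _ T], THEN mp, OF T,
      THEN spec[of _ 1], THEN mp, OF zero_less_one]
  then obtain \<delta> where \<delta>: "0 < \<delta>"
    and AC': "\<forall>(n::nat) a b. (\<forall>i<n. 0 \<le> a i \<and> a i \<le> b i \<and> b i \<le> T) \<longrightarrow>
      disjoint_family_on (\<lambda>i. {a i<..<b i}) {..<n} \<longrightarrow> (\<Sum>i<n. b i - a i) < \<delta> \<longrightarrow>
      (\<Sum>i<n. Linf_norm \<mu> (\<lambda>x. r (b i) x - r (a i) x)) < 1"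
    by (elim exE conjE) (rule that)
  have step: "Linf_norm \<mu> (\<lambda>x. r t x - r s x) < 1"
    if "0 \<le> s" "s \<le> t" "t \<le> T" "t - s < \<delta>" for s t
    using AC'[rule_format, of 1 "\<lambda>_. s" "\<lambda>_. t"] that by (simp add: disjoint_family_on_def)
  have bound: "AE x in \<mu>. \<bar>r t x\<bar> \<le> Linf_norm \<mu> (r 0) + n"
    if "0 \<le> t" "t \<le> T" "t \<le> n * (\<delta> / 2)" for t and n :: nat
    using that
  proof (induction n arbitrary: t)
    case 0
    then show ?case using AE_abs_le_Linf_norm[OF r[of 0]] by simp
  next
    case (Suc n)
    \<comment> \<open>A step of \<open>\<delta> / 2\<close> keeps \<open>t - s\<close> strictly
      below \<open>\<delta>\<close>; the maximum prevents negative times.\<close>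
    define s where "s = max 0 (t - \<delta> / 2)"
    have s: "0 \<le> s" "s \<le> t" "t - s < \<delta>" "s \<le> n * (\<delta> / 2)"
      using Suc.prems \<delta> by (auto simp: s_def algebra_simps max_def)
    have "AE x in \<mu>. \<bar>r t x - r s x\<bar> \<le> Linf_norm \<mu> (\<lambda>x. r t x - r s x)"
      using s Suc.prems by (intro AE_abs_le_Linf_norm Linf_diff r) auto
    moreover have "AE x in \<mu>. \<bar>r s x\<bar> \<le> Linf_norm \<mu> (r 0) + n"
      using s Suc by auto
    ultimately show ?case
    proof eventually_elim
      case (elim x)
      then show ?case using step[OF s(1,2) Suc.prems(2) s(3)] by simp
    qed
  qed
  obtain n :: nat where "T < n * (\<delta> / 2)"
    using \<delta> reals_Archimedean3[of "\<delta> / 2"] by auto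
  with bound[of _ n] show ?thesis
    by (intro that[of "Linf_norm \<mu> (r 0) + n"]) auto
qed

section \<open>Weights and velocity\<close>

text \<open>Translates the Lebesgue integrals from \<open>0\<close> in the notion of solution into
  Henstock-Kurzweil increments on arbitrary intervals, the form in which the comparison lemmas take
  their hypotheses.\<close>

lemma has_integral_increment:
  fixes f u :: "real \<Rightarrow> real"
  assumes int: "\<And>T. 0 < T \<Longrightarrow> set_integrable lborel {0..T} f"
    and u: "\<And>t. 0 \<le> t \<Longrightarrow> u t = u0 + (LINT s:{0..t}|lborel. f s)"
    and st: "0 \<le> s" "s \<le> t"
  shows "(f has_integral (u t - u s)) {s..t}"
proof -
  \<comment> \<open>The hypothesis speaks of positive \<open>T\<close> only; passing through
    \<open>b + 1\<close> includes \<open>b = 0\<close>.\<close>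
  have int': "set_integrable lborel {0..b} f" if "0 \<le> b" for b
    by (rule set_integrable_subset[OF int[of "b + 1"]]) (use that in auto)
  then have eq: "u b = u0 + integral {0..b} f" and on: "f integrable_on {0..b}" if "0 \<le> b" for b
    using set_borel_integral_eq_integral[of "{0..b}" f] u that by auto
  have "integral {0..s} f + integral {s..t} f = integral {0..t} f"
    using st on by (intro Henstock_Kurzweil_Integration.integral_combine) auto
  then have "integral {s..t} f = u t - u s"
    using eq st by simp
  moreover have "f integrable_on {s..t}"
    using on[of t] st by (auto intro: integrable_on_subinterval)
  ultimately show ?thesis by (simp add: has_integral_iff)
qed

text \<open>A value beyond \<open>R\<close> would persist near \<open>t\<close>, hence at some
  rational time. Thus countably many null sets suffice for a bound at all times.\<close>

lemma bounded_if_bounded_on_Rats: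
  fixes u :: "real \<Rightarrow> real"
  assumes cont: "continuous_on {a..b} u" and ab: "a < b"
    and bound: "\<And>q. q \<in> \<rat> \<Longrightarrow> a \<le> q \<Longrightarrow> q \<le> b \<Longrightarrow> \<bar>u q\<bar> \<le> R"
    and t: "a \<le> t" "t \<le> b"
  shows "\<bar>u t\<bar> \<le> R"
proof (rule ccontr)
  assume "\<not> \<bar>u t\<bar> \<le> R"
  then obtain d where d: "0 < d" "\<And>s. s \<in> {a..b} \<Longrightarrow> dist s t < d \<Longrightarrow> dist (u s) (u t) < \<bar>u t\<bar> - R"
    using cont t unfolding continuous_on_iff
    by (metis atLeastAtMost_iff diff_gt_0_iff_gt linorder_not_le)
  \<comment> \<open>Since \<open>a < b\<close>, the neighbourhood meets \<open>[a, b]\<close> in a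
    nondegenerate interval even when \<open>t\<close> is an end point.\<close>
  have "max a (t - d) < min b (t + d)" using d t ab by auto
  then obtain q where q: "q \<in> \<rat>" "max a (t - d) < q" "q < min b (t + d)"
    using Rats_dense_in_real by blast
  then have "dist (u q) (u t) < \<bar>u t\<bar> - R" "\<bar>u q\<bar> \<le> R"
    using d(2)[of q] bound[of q] by (auto simp: dist_real_def)
  then show False by (simp add: dist_real_def)
qed

text \<open>\<open>[0, H]\<close> is invariant under \<open>e' = w - e\<close>: at or below
  \<open>0\<close> the right-hand side is nonnegative, at or above \<open>H\<close> it is
  nonpositive. So \<open>barrier\<close> applies to \<open>- e\<close> and to \<open>e - H\<close>
  with majorant zero.\<close>

lemma relaxation_bounds:
  fixes e w :: "real \<Rightarrow> real"
  assumes int: "\<And>s t. 0 \<le> s \<Longrightarrow> s \<le> t \<Longrightarrow> ((\<lambda>\<tau>. w \<tau> - e \<tau>) has_integral (e t - e s)) {s..t}"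
    and w: "\<And>t. 0 \<le> t \<Longrightarrow> 0 \<le> w t" "\<And>t. 0 \<le> t \<Longrightarrow> w t \<le> H"
    and e0: "0 \<le> e 0" "e 0 \<le> H"
    and t: "0 \<le> t"
  shows "0 \<le> e t" "e t \<le> H"
proof -
  have zero: "((\<lambda>_. 0) has_integral (0 - 0)) {s..t}" for s t :: real by simp
  have neg: "((\<lambda>\<tau>. - (w \<tau> - e \<tau>)) has_integral (- e t - - e s)) {s..t}" if "0 \<le> s" "s \<le> t" for s t
    using has_integral_neg[OF int[OF that]] by (simp add: algebra_simps)
  have "- e t \<le> 0"
  proof (rule barrier[OF neg zero, of t])
    fix s assume "0 \<le> s" "0 \<le> - e s"
    with w(1)[of s] show "- (w s - e s) \<le> 0" by linarith
  qed (use e0 t in auto)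
  then show "0 \<le> e t" by simp
  have shift: "((\<lambda>\<tau>. w \<tau> - e \<tau>) has_integral ((e t - H) - (e s - H))) {s..t}"
    if "0 \<le> s" "s \<le> t" for s t
    using int[OF that] by simp
  have "e t - H \<le> 0"
  proof (rule barrier[OF shift zero, of t])
    fix s assume "0 \<le> s" "0 \<le> e s - H"
    with w(2)[of s] show "w s - e s \<le> 0" by linarith
  qed (use e0 t in auto)
  then show "e t \<le> H" by simp
qed

text \<open>The difference \<open>d\<close> of two solutions satisfies \<open>d' = - d\<close>, so
  neither \<open>d\<close> nor \<open>- d\<close> can rise above \<open>0\<close>. Applied to a
  weight and its transpose, this gives the symmetry of the weights.\<close>

lemma relaxation_unique:
  fixes e e' w :: "real \<Rightarrow> real"
  assumes e: "\<And>s t. 0 \<le> s \<Longrightarrow> s \<le> t \<Longrightarrow> ((\<lambda>\<tau>. w \<tau> - e \<tau>) has_integral (e t - e s)) {s..t}"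
    and e': "\<And>s t. 0 \<le> s \<Longrightarrow> s \<le> t \<Longrightarrow> ((\<lambda>\<tau>. w \<tau> - e' \<tau>) has_integral (e' t - e' s)) {s..t}"
    and "e 0 = e' 0" "0 \<le> t"
  shows "e t = e' t"
proof -
  have d: "((\<lambda>\<tau>. 0 - (e \<tau> - e' \<tau>)) has_integral ((e t - e' t) - (e s - e' s))) {s..t}"
    if "0 \<le> s" "s \<le> t" for s t
    using has_integral_diff[OF e[OF that] e'[OF that]] by (simp add: algebra_simps)
  have d': "((\<lambda>\<tau>. 0 - (e' \<tau> - e \<tau>)) has_integral ((e' t - e t) - (e' s - e s))) {s..t}"
    if "0 \<le> s" "s \<le> t" for s t
    using has_integral_diff[OF e'[OF that] e[OF that]] by (simp add: algebra_simps)
  have zero: "((\<lambda>_. 0) has_integral (0 - 0)) {s..t}" for s t :: real by simp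
  have "e t - e' t \<le> 0" "e' t - e t \<le> 0"
    by (rule barrier[OF d zero, of t] barrier[OF d' zero, of t]; use assms in simp)+
  then show ?thesis by simp
qed

text \<open>\<open>real_of_ereal\<close> turns an infinite infimum into \<open>0\<close>, so the
  lower bound rests on finiteness: nonnegativity excludes \<open>-\<infinity>\<close>, and a pair in
  \<open>D\<close> excludes \<open>\<infinity>\<close>.\<close>

lemma eta_star_bounds:
  assumes "\<And>t p. 0 \<le> t \<Longrightarrow> p \<in> D \<Longrightarrow> 0 \<le> \<eta> t p"
  shows "0 \<le> eta_star D \<eta>" "0 \<le> t \<Longrightarrow> p \<in> D \<Longrightarrow> eta_star D \<eta> \<le> \<eta> t p"
proof -
  let ?I = "INF t\<in>{0..}. INF p\<in>D. ereal (\<eta> t p)"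
  have nonneg: "0 \<le> ?I" using assms by (auto intro!: INF_greatest)
  then show "0 \<le> eta_star D \<eta>" by (simp add: eta_star_def real_of_ereal_pos)
  assume "0 \<le> t" "p \<in> D"
  then have "?I \<le> ereal (\<eta> t p)"
    by (intro INF_lower2[of t] INF_lower2[of p]) auto
  with nonneg show "eta_star D \<eta> \<le> \<eta> t p"
    unfolding eta_star_def by (cases ?I) auto
qed

section \<open>Monotonicity and Lipschitz bounds for \<alpha>\<close>

lemma increasing_on_compacts_deriv_pos:
  assumes "increasing_on_compacts \<alpha>"
  shows "0 < deriv \<alpha> x"
proof -
  obtain c where "0 < c" "c < deriv \<alpha> x"
    using assms[unfolded increasing_on_compacts_def, rule_format, of "{x}"] by auto
  then show ?thesis by simp
qed

lemma C1b_DERIV: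
  assumes "C1b \<alpha>"
  shows "(\<alpha> has_real_derivative deriv \<alpha> x) (at x)"
  using assms by (simp add: C1b_def DERIV_deriv_iff_real_differentiable)

lemma increasing_on_compacts_mono:
  assumes "C1b \<alpha>" "increasing_on_compacts \<alpha>"
  shows "mono \<alpha>"
proof (rule monoI)
  fix x y :: real assume "x \<le> y"
  then show "\<alpha> x \<le> \<alpha> y"
    by (rule DERIV_nonneg_imp_nondecreasing)
      (use C1b_DERIV[OF assms(1)] increasing_on_compacts_deriv_pos[OF assms(2)] in
        \<open>auto intro: less_imp_le\<close>)
qed

lemma C1b_Lipschitz:
  assumes "C1b \<alpha>"
  obtains L where "\<And>a b. \<bar>\<alpha> a - \<alpha> b\<bar> \<le> L * \<bar>a - b\<bar>"
proof -
  obtain L where "\<And>x. \<bar>deriv \<alpha> x\<bar> \<le> L"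
    using assms by (auto simp: C1b_def bounded_iff)
  then have "\<bar>\<alpha> a - \<alpha> b\<bar> \<le> L * \<bar>a - b\<bar>" for a b
    using field_differentiable_bound[of UNIV \<alpha> "deriv \<alpha>" L a b] C1b_DERIV[OF assms] by simp
  with that show ?thesis by blast
qed

text \<open>On the compact set \<open>{0..R}\<close> the derivative stays above a positive constant,
  which makes the real infimum positive and a genuine lower bound. The mean value theorem then gives
  the second part.\<close>

lemma alpha_star_bounds:
  assumes \<alpha>: "C1b \<alpha>" "increasing_on_compacts \<alpha>" and R: "0 \<le> R"
  shows "0 < alpha_star \<alpha> R"
    and "0 \<le> b \<Longrightarrow> b \<le> a \<Longrightarrow> a \<le> R \<Longrightarrow> alpha_star \<alpha> R * (a - b) \<le> \<alpha> a - \<alpha> b"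
proof -
  obtain c where c: "0 < c" "\<And>x. 0 \<le> x \<Longrightarrow> x \<le> R \<Longrightarrow> c < deriv \<alpha> x"
    using \<alpha>(2)[unfolded increasing_on_compacts_def, rule_format, of "{0..R}"] by auto
  have "c \<le> alpha_star \<alpha> R"
    unfolding alpha_star_def using R c by (intro cINF_greatest) (auto intro: less_imp_le)
  with c show "0 < alpha_star \<alpha> R" by simp
  have lower: "alpha_star \<alpha> R \<le> deriv \<alpha> y" if "0 \<le> y" "y \<le> R" for y
    unfolding alpha_star_def
    using that c by (intro cINF_lower) (auto intro!: bdd_belowI[of _ c] less_imp_le)
  assume ab: "0 \<le> b" "b \<le> a" "a \<le> R"
  show "alpha_star \<alpha> R * (a - b) \<le> \<alpha> a - \<alpha> b"
  proof (cases "b < a")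
    case True
    then obtain z where "b < z" "z < a" "\<alpha> a - \<alpha> b = (a - b) * deriv \<alpha> z"
      using MVT2[of b a \<alpha> "deriv \<alpha>"] C1b_DERIV[OF \<alpha>(1)] by blast
    with lower[of z] ab show ?thesis by (simp add: mult.commute mult_left_mono)
  qed (use ab in simp)
qed

text \<open>\<open>\<phi>\<close> is the explicit solution of the logistic equation with
  \<open>\<phi> 0 = R\<close>. The identity \<open>\<phi> s - M = M * (R - M) / ?d\<close> gives
  both the sign and the form of the derivative.\<close>

lemma logistic:
  fixes R M c :: real
  assumes RM: "0 < M" "M \<le> R" and c: "0 \<le> c" and s: "0 \<le> s"
  defines "\<phi> \<equiv> \<lambda>t. R * M * exp (c * M * t) / (R * (exp (c * M * t) - 1) + M)"
  shows "(\<phi> has_real_derivative - c * \<phi> s * (\<phi> s - M)) (at s)" and "M \<le> \<phi> s"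
proof -
  let ?e = "exp (c * M * s)" and ?d = "R * (exp (c * M * s) - 1) + M"
  have "1 \<le> ?e" using assms by simp
  then have "0 \<le> R * (?e - 1)" using RM by (intro mult_nonneg_nonneg) auto
  then have d: "0 < ?d" using RM by linarith
  have diff: "\<phi> s - M = M * (R - M) / ?d"
    using d by (simp add: \<phi>_def field_simps)
  moreover have "0 \<le> M * (R - M) / ?d" using d RM by (intro divide_nonneg_pos mult_nonneg_nonneg) auto
  ultimately show "M \<le> \<phi> s" by linarith
  have "(\<phi> has_real_derivative
      (R * M * (?e * (c * M)) * ?d - R * M * ?e * (R * (?e * (c * M)))) / (?d * ?d)) (at s)"
    unfolding \<phi>_def using d by (auto intro!: derivative_eq_intros)
  also have "(R * M * (?e * (c * M)) * ?d - R * M * ?e * (R * (?e * (c * M)))) / (?d * ?d) =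
      - c * (R * M * ?e / ?d) * (M * (R - M) / ?d)"
    using d by (simp add: divide_simps) (simp add: algebra_simps)
  finally show "(\<phi> has_real_derivative - c * \<phi> s * (\<phi> s - M)) (at s)"
    unfolding diff by (simp add: \<phi>_def)
qed

text \<open>\<open>omega_star\<close> gives no bound at functions that vanish almost everywhere; these are reached by
  approximation with small constants.\<close>

lemma omega_nonneg:
  assumes "prob_space \<mu>" and pos: "0 < omega_star \<mu> D \<omega>"
    and Lip: "\<And>f g. f \<in> Linf \<mu> \<Longrightarrow> g \<in> Linf \<mu> \<Longrightarrow>
      \<bar>\<omega> t f p - \<omega> t g p\<bar> \<le> L * Linf_norm \<mu> (\<lambda>z. f z - g z)" and L: "0 \<le> L"
    and t: "0 \<le> t" and p: "p \<in> D" and f: "f \<in> Linf \<mu>"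
  shows "0 \<le> \<omega> t f p"
proof -
  interpret prob_space \<mu> by fact
  have pos': "0 \<le> \<omega> t g p" if "g \<in> Linf \<mu>" "\<not> (AE x in \<mu>. g x = 0)" for g
  proof -
    have "omega_star \<mu> D \<omega> \<le> ereal (\<omega> t g p)"
      unfolding omega_star_def
      using that t p by (intro INF_lower2[of t] INF_lower2[of p] INF_lower2[of g]) auto
    with pos have "ereal 0 < ereal (\<omega> t g p)" unfolding zero_ereal_def[symmetric] by (rule less_le_trans)
    then show ?thesis by simp
  qed
  show ?thesis
  proof (cases "AE x in \<mu>. f x = 0")
    case True
    have "- \<omega> t f p \<le> \<epsilon>" if \<epsilon>: "0 < \<epsilon>" for \<epsilon>
    proof -
      \<comment> \<open>The denominator \<open>L + 1\<close> also serves
        \<open>L = 0\<close>.\<close>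
      define d where "d = \<epsilon> / (L + 1)"
      have d: "0 < d" "L * d \<le> \<epsilon>" using \<epsilon> L by (auto simp: d_def field_simps)
      have const: "(\<lambda>_. d) \<in> Linf \<mu>" by (rule LinfI[of _ _ "\<bar>d\<bar>"]) auto
      have "Linf_norm \<mu> (\<lambda>z. f z - d) \<le> d"
        using f True d by (intro Linf_norm_le) (auto simp: Linf_def)
      then have "L * Linf_norm \<mu> (\<lambda>z. f z - d) \<le> \<epsilon>"
        using mult_left_mono[OF _ L] d by (meson order_trans)
      moreover have "0 \<le> \<omega> t (\<lambda>_. d) p" using const d by (intro pos') auto
      ultimately show ?thesis using Lip[OF f const] by linarith
    qed
    then have "- \<omega> t f p \<le> 0" by (rule field_le_epsilon) simp
    then show ?thesis by simp
  qed (use pos' f in blast)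
qed

section \<open>The maximum principle and the decay estimate\<close>

text \<open>The supremum is taken in the extended reals, so that the first claim includes
  boundedness. In the second, \<open>E = 0\<close> would make the right-hand side \<open>0\<close>
  by the convention \<open>x / 0 = 0\<close>, hence the condition \<open>E \<noteq> 0\<close>. The
  value \<open>0\<close> of \<open>eta_star\<close> also arises when \<open>D\<close> is
  empty.\<close>

theorem theorem5p4:
  fixes \<mu> :: "(real ^ 'd) measure"
    and K :: "(real ^ 'd) set"
    and D :: "((real ^ 'd) \<times> (real ^ 'd)) set"
    and r :: "real \<Rightarrow> real ^ 'd \<Rightarrow> real"
    and \<eta> :: "real \<Rightarrow> (real ^ 'd) \<times> (real ^ 'd) \<Rightarrow> real"
    and r0 :: "real ^ 'd \<Rightarrow> real"
    and \<eta>0 :: "(real ^ 'd) \<times> (real ^ 'd) \<Rightarrow> real"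
    and V \<omega> :: "real \<Rightarrow> (real ^ 'd \<Rightarrow> real) \<Rightarrow> (real ^ 'd) \<times> (real ^ 'd) \<Rightarrow> real"
    and v :: "real \<Rightarrow> real \<Rightarrow> real \<Rightarrow> real"
    and \<alpha> :: "real \<Rightarrow> real"
    and C_V L_V L_\<omega> C_\<omega> M :: real
  defines "K \<equiv> supp \<mu>"
    and "D \<equiv> off_diag (supp \<mu>)"
  assumes mu: "prob_space \<mu>" "sets \<mu> = sets borel" "compact K"
    (* solution *)
    and r_AC: "AC_curve (Linf_norm \<mu>) (Linf \<mu>) r"
    and eta_AC: "AC_curve (sup_norm_on D) (Cb D) \<eta>"
    and sol: "Euler_CoNCL_solution \<mu> Phi_upwind v \<omega> r0 \<eta>0 r \<eta>"
    (* velocity *)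
    and V_antisym: "\<And>t g. t \<ge> 0 \<Longrightarrow> g \<in> Linf \<mu> \<Longrightarrow> antisym_fun_on D (V t g)"
    and V_cont: "\<And>g p. g \<in> Linf \<mu> \<Longrightarrow> p \<in> D \<Longrightarrow> continuous_on {0..} (\<lambda>t. V t g p)"
    and V_pointwise: "pointwise_velocity \<mu> V v"
    and V_monotonic: "monotonic_velocity \<mu> v"
    and V_form: "\<And>t a b. t \<ge> 0 \<Longrightarrow> v t a b = \<alpha> a - \<alpha> b"
    and alpha: "C1b \<alpha>" "increasing_on_compacts \<alpha>"
    and V_consts: "C_V > 0" "L_V > 0"
    and V_bounded: "\<And>t g. t \<ge> 0 \<Longrightarrow> g \<in> Linf \<mu> \<Longrightarrow>
          AE x in \<mu>. AE x' in \<mu>. (x, x') \<in> D \<longrightarrow> \<bar>v t (g x) (g x')\<bar> \<le> C_V"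
    and V_Lipschitz: "\<And>t g h. t \<ge> 0 \<Longrightarrow> g \<in> Linf \<mu> \<Longrightarrow> h \<in> Linf \<mu> \<Longrightarrow>
          AE x in \<mu>. AE x' in \<mu>. (x, x') \<in> D \<longrightarrow>
            \<bar>v t (g x) (g x') - v t (h x) (h x')\<bar> \<le> L_V * Linf_norm \<mu> (\<lambda>z. g z - h z)"
    (* weight dynamics *)
    and omega_cont: "\<And>t f. t \<ge> 0 \<Longrightarrow> f \<in> Linf \<mu> \<Longrightarrow> continuous_on D (\<omega> t f)"
    and omega_sym: "\<And>t f. t \<ge> 0 \<Longrightarrow> f \<in> Linf \<mu> \<Longrightarrow> symmetric_fun_on D (\<omega> t f)"
    and omega_L1: "\<And>T f p. T > 0 \<Longrightarrow> f \<in> Linf \<mu> \<Longrightarrow> p \<in> D \<Longrightarrow>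
          set_integrable lborel {0..T} (\<lambda>t. \<omega> t f p)"
    and omega_consts: "L_\<omega> \<ge> 0" "C_\<omega> > 0"
    and omega_Lipschitz: "\<And>t f g p. t \<ge> 0 \<Longrightarrow> f \<in> Linf \<mu> \<Longrightarrow> g \<in> Linf \<mu> \<Longrightarrow> p \<in> D \<Longrightarrow>
          \<bar>\<omega> t f p - \<omega> t g p\<bar> \<le> L_\<omega> * Linf_norm \<mu> (\<lambda>z. f z - g z)"
    and omega_bounded: "\<And>t f p. t \<ge> 0 \<Longrightarrow> f \<in> Linf \<mu> \<Longrightarrow> p \<in> D \<Longrightarrow> \<bar>\<omega> t f p\<bar> \<le> C_\<omega>"
    and omega_pos: "omega_star \<mu> D \<omega> > 0"
    (* initial data *)
    and r0: "r0 \<in> Linf \<mu>" "AE x in \<mu>. r0 x \<ge> 0" "(LINT x:K|\<mu>. r0 x) = M"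
    and eta0: "\<eta>0 \<in> Cb D" "symmetric_fun_on D \<eta>0" "\<And>p. p \<in> D \<Longrightarrow> \<eta>0 p > 0"
  shows "(SUP t\<in>{0..}. ereal (Linf_norm \<mu> (r t))) \<le> ereal (Linf_norm \<mu> r0)
     \<and> (let R0 = Linf_norm \<mu> r0; A = alpha_star \<alpha> R0; E = eta_star D \<eta>
        in E \<noteq> 0 \<longrightarrow>
          (\<forall>t\<ge>0. Linf_norm \<mu> (r t) \<le>
             (R0 * A * E * M * exp (A * E * M * t)) /
             (A * E * (R0 * measure \<mu> K * (exp (A * E * M * t) - 1) + M))))"
proof -
  interpret prob_space \<mu> by fact
  have UNIV_mu: "space \<mu> = UNIV"
    using sets_eq_imp_space_eq[OF mu(2)] by simp
  have AE_K: "AE x in \<mu>. x \<in> K"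
    unfolding K_def using mu(2) by (rule AE_in_supp)
  have K_borel [measurable]: "K \<in> sets borel"
    using mu(3) by (intro borel_closed compact_imp_closed)
  have "D = K \<times> K \<inter> - {p. fst p = snd p}"
    by (auto simp: D_def K_def off_diag_def)
  moreover have "- {p :: (real ^ 'd) \<times> (real ^ 'd). fst p = snd p} \<in> sets borel"
    by (intro borel_open open_Compl closed_Collect_eq continuous_intros)
  ultimately have D_borel: "D \<in> sets borel"
    using borel_Times[OF K_borel K_borel] by auto
  have D_swap: "(y, x) \<in> D" if "(x, y) \<in> D" for x y
    using that by (auto simp: D_def off_diag_def)
  have r_Linf: "r t \<in> Linf \<mu>" if "0 \<le> t" for t
    using r_AC that by (simp add: AC_curve_def)
  have eta_Cb: "\<eta> t \<in> Cb D" if "0 \<le> t" for t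
    using eta_AC that by (simp add: AC_curve_def)

  \<comment> \<open>Bounds, symmetry and time regularity of the weights\<close>
  define w where "w p s = \<omega> s (r s) p" for p s
  have w: "0 \<le> w p s" "w p s \<le> C_\<omega>" if "p \<in> D" "0 \<le> s" for p s
  proof -
    show "0 \<le> w p s"
      unfolding w_def using that omega_consts(1) r_Linf
      by (intro omega_nonneg[where D = D, OF mu(1) omega_pos omega_Lipschitz])
    show "w p s \<le> C_\<omega>"
      using omega_bounded[OF that(2) r_Linf[OF that(2)] that(1)] by (simp add: w_def)
  qed
  have eta_int: "((\<lambda>s. w p s - \<eta> s p) has_integral (\<eta> t p - \<eta> s p)) {s..t}"
    if "p \<in> D" "0 \<le> s" "s \<le> t" for p s t
    unfolding w_def
    by (rule has_integral_increment[of _ "\<lambda>t. \<eta> t p" "\<eta>0 p", OF _ _ that(2,3)])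
      (use sol that(1) in \<open>auto simp: Euler_CoNCL_solution_def Let_def D_def\<close>)
  have eta_0: "\<eta> 0 p = \<eta>0 p" if "p \<in> D" for p
    using sol that by (simp add: Euler_CoNCL_solution_def Let_def D_def set_borel_integral_eq_integral)
  obtain H0 where H0: "\<And>p. p \<in> D \<Longrightarrow> \<bar>\<eta>0 p\<bar> \<le> H0"
    using eta0(1) by (auto simp: Cb_def bounded_iff)
  \<comment> \<open>\<open>H\<close> dominates both the initial weights and the source
    \<open>w\<close>, so that \<open>relaxation_bounds\<close> applies.\<close>
  define H where "H = max H0 C_\<omega>"
  have H: "C_\<omega> \<le> H" "0 \<le> H"
    using omega_consts by (auto simp: H_def)
  have eta: "0 \<le> \<eta> t p" "\<eta> t p \<le> H" if "p \<in> D" "0 \<le> t" for t p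
  proof -
    have e0: "0 \<le> \<eta> 0 p" "\<eta> 0 p \<le> H"
      using eta_0 H0[of p] eta0(3)[of p] that by (auto simp: H_def)
    show "0 \<le> \<eta> t p" "\<eta> t p \<le> H"
      using relaxation_bounds[of "w p" "\<lambda>t. \<eta> t p" H t, OF eta_int[OF that(1)]]
        w[OF that(1)] e0 H that by (force intro: order_trans)+
  qed
  have eta_sym: "\<eta> t (x, y) = \<eta> t (y, x)" if xy: "(x, y) \<in> D" and t: "0 \<le> t" for t x y
  proof (rule relaxation_unique[where w = "w (x, y)" and t = t])
    have "w (x, y) s = w (y, x) s" if "0 \<le> s" for s
      using omega_sym[OF that r_Linf[OF that]] xy by (auto simp: symmetric_fun_on_def w_def)
    then show "((\<lambda>s. w (x, y) s - \<eta> s (y, x)) has_integral (\<eta> t (y, x) - \<eta> s (y, x))) {s..t}"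
      if "0 \<le> s" "s \<le> t" for s t
      using eta_int[OF D_swap[OF xy] that] that
      by (subst has_integral_cong[where g = "\<lambda>s. w (y, x) s - \<eta> s (y, x)"]) auto
    show "\<eta> 0 (x, y) = \<eta> 0 (y, x)"
      using eta0(2) eta_0 xy D_swap[OF xy] by (auto simp: symmetric_fun_on_def)
  qed (use eta_int xy t in auto)
  have eta_Lipschitz: "\<bar>\<eta> t p - \<eta> s p\<bar> \<le> (C_\<omega> + H) * (t - s)"
    if "p \<in> D" "0 \<le> s" "s \<le> t" for p s t
  proof (rule has_integral_abs_le[OF eta_int[OF that] that(3)])
    fix \<tau> assume "s \<le> \<tau>"
    then show "\<bar>w p \<tau> - \<eta> \<tau> p\<bar> \<le> C_\<omega> + H"
      using w[OF that(1), of \<tau>] eta[OF that(1), of \<tau>] that H omega_consts by auto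
  qed
  \<comment> \<open>As \<open>\<eta>\<close> is controlled only on \<open>D\<close>, it is cut off
    outside: this gives Borel measurability on the product and bounds at all pairs.\<close>
  define k where "k t x y = indicator D (x, y) * \<eta> t (x, y)" for t x y

  \<comment> \<open>Constants and the initial datum\<close>
  define R0 where "R0 = Linf_norm \<mu> r0"
  have R0: "0 \<le> R0" unfolding R0_def using r0(1) by (rule Linf_norm_nonneg)
  obtain L where L: "\<And>a b. \<bar>\<alpha> a - \<alpha> b\<bar> \<le> L * \<bar>a - b\<bar>"
    using C1b_Lipschitz[OF alpha(1)] by blast
  define A where "A = alpha_star \<alpha> R0"
  define E where "E = eta_star D \<eta>"
  have A: "0 < A" using alpha_star_bounds(1)[OF alpha R0] by (simp add: A_def)
  have E: "0 \<le> E" "0 \<le> t \<Longrightarrow> p \<in> D \<Longrightarrow> E \<le> \<eta> t p" for t p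
    using eta_star_bounds(1)[of D \<eta>] eta_star_bounds(2)[of D \<eta> t p] eta by (auto simp: E_def)
  have r0_int: "integrable \<mu> r0"
    using AE_abs_le_Linf_norm[OF r0(1)] r0(1) by (intro integrable_const_bound[of _ R0])
      (auto simp: R0_def Linf_def)
  have r0_meas [measurable]: "r0 \<in> borel_measurable \<mu>"
    using r0(1) by (simp add: Linf_def)
  have K_mu [measurable]: "K \<in> sets \<mu>"
    using K_borel mu(2) by simp
  have "(LINT x:K|\<mu>. r0 x) = (LINT x|\<mu>. r0 x)"
    unfolding set_lebesgue_integral_def
  proof (rule integral_cong_AE)
    show "AE x in \<mu>. indicator K x *\<^sub>R r0 x = r0 x"
      using AE_K by eventually_elim simp
  qed measurable
  then have M_eq: "M = (LINT x|\<mu>. r0 x)"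
    using r0(3) by simp
  have r0_le: "AE x in \<mu>. r0 x \<le> R0"
    using AE_abs_le_Linf_norm[OF r0(1)] unfolding R0_def by eventually_elim simp
  have M: "0 \<le> M" "M \<le> R0"
    unfolding M_eq using integral_nonneg_AE[OF r0(2)] integral_le_const[OF r0_int r0_le] by auto

  \<comment> \<open>Both estimates at a fixed time\<close>
  have bounds: "Linf_norm \<mu> (r t) \<le> R0 \<and> (E \<noteq> 0 \<longrightarrow> 0 < M \<longrightarrow> Linf_norm \<mu> (r t) \<le>
      R0 * M * exp (A * E * M * t) / (R0 * (exp (A * E * M * t) - 1) + M))"
    if t: "0 \<le> t" for t
  proof -
    \<comment> \<open>The horizon is positive also for \<open>t = 0\<close>.\<close>
    define T where "T = t + 1"
    have T: "0 < T" "t \<le> T" using t by (auto simp: T_def)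
    obtain R where R: "\<And>t. 0 \<le> t \<Longrightarrow> t \<le> T \<Longrightarrow> AE x in \<mu>. \<bar>r t x\<bar> \<le> R"
      using AC_curve_Linf_bounded[OF r_AC T(1)] by blast
    have R_nonneg: "0 \<le> R"
    proof -
      have "AE x in \<mu>. 0 \<le> R" using R[OF order_refl less_imp_le[OF T(1)]] by eventually_elim linarith
      then show ?thesis by simp
    qed
    txt \<open>The exceptional null set in the notion of solution does not depend on time, but those of the
      bounds by \<open>R\<close> do; continuity in time reduces the latter to rational times.\<close>
    define fl where "fl x s =
      (LINT y|\<mu>. Phi_upwind (r s x) (r s y) (\<alpha> (r s x) - \<alpha> (r s y)) * k s x y)" for x s
    define G where "G = {x \<in> K.
      (\<forall>s t. 0 \<le> s \<longrightarrow> s \<le> t \<longrightarrow> (fl x has_integral (r s x - r t x)) {s..t}) \<and>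
      r 0 x = r0 x \<and> 0 \<le> r0 x \<and> r0 x \<le> R0 \<and> (\<forall>q\<in>\<rat> \<inter> {0..T}. \<bar>r q x\<bar> \<le> R)}"
    have "AE x in \<mu>. \<forall>q\<in>\<rat> \<inter> {0..T}. \<bar>r q x\<bar> \<le> R"
      by (subst AE_ball_countable) (auto intro: countable_rat R)
    moreover have "AE x in \<mu>. x \<in> K \<longrightarrow>
      (\<forall>s t. 0 \<le> s \<longrightarrow> s \<le> t \<longrightarrow> (fl x has_integral (r s x - r t x)) {s..t}) \<and> r 0 x = r0 x"
      using conjunct1[OF sol[unfolded Euler_CoNCL_solution_def Let_def, folded K_def]]
    proof eventually_elim
      case (elim x)
      show ?case
      proof (intro impI conjI allI)
        assume x: "x \<in> K"
        let ?f = "\<lambda>s. LINT y:K - {x}|\<mu>.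
          Phi_upwind (r s x) (r s y) (v s (r s x) (r s y)) * \<eta> s (x, y)"
        have int: "set_integrable lborel {0..T} ?f" if "0 < T" for T
          using elim x that by simp
        have eq: "r t x = r0 x - (LINT s:{0..t}|lborel. ?f s)" if "0 \<le> t" for t
          using elim x that by simp
        show "r 0 x = r0 x"
          using eq[of 0] by (simp add: set_borel_integral_eq_integral)
        fix s t :: real assume st: "0 \<le> s" "s \<le> t"
        have "(?f has_integral (- r t x - - r s x)) {s..t}"
          by (rule has_integral_increment[of _ "\<lambda>t. - r t x" "- r0 x", OF int _ st]) (simp_all add: eq)
        \<comment> \<open>For \<open>x\<close> in \<open>K\<close>, the indicator of
          \<open>K - {x}\<close> at \<open>y\<close> equals that of \<open>D\<close> at
          \<open>(x, y)\<close>, so the flux becomes an integral over the whole space.\<close>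
        moreover have "?f \<tau> = fl x \<tau>" if "0 \<le> \<tau>" for \<tau>
          unfolding fl_def set_lebesgue_integral_def k_def using x that
          by (intro Bochner_Integration.integral_cong)
            (auto simp: indicator_def V_form D_def off_diag_def K_def)
        ultimately show "(fl x has_integral (r s x - r t x)) {s..t}"
          using st by (subst has_integral_cong[where g = ?f]) auto
      qed
    qed
    ultimately have AE_G: "AE x in \<mu>. x \<in> G"
      using AE_K r0(2) AE_abs_le_Linf_norm[OF r0(1)] unfolding G_def R0_def
      by eventually_elim auto
    interpret flow: upwind_flow \<mu> G \<alpha> k r T L H "C_\<omega> + H" R
    proof
      show "AE x in \<mu>. x \<in> G" by fact
      show "mono \<alpha>" using alpha by (rule increasing_on_compacts_mono)
      show "\<bar>\<alpha> a - \<alpha> b\<bar> \<le> L * \<bar>a - b\<bar>" for a b by (rule L)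
      show "(\<lambda>p. k t (fst p) (snd p)) \<in> borel_measurable (\<mu> \<Otimes>\<^sub>M \<mu>)" if "0 \<le> t" for t
      proof -
        have "(\<lambda>p. indicator D p *\<^sub>R \<eta> t p) \<in> borel_measurable borel"
          using D_borel eta_Cb[OF that]
          by (intro borel_measurable_continuous_on_indicator) (auto simp: Cb_def)
        moreover have sets: "sets (\<mu> \<Otimes>\<^sub>M \<mu>) = sets borel"
          unfolding borel_prod[symmetric] using mu(2) by (intro sets_pair_measure_cong)
        ultimately show ?thesis
          unfolding measurable_cong_sets[OF sets refl] by (simp add: k_def)
      qed
      show "k t x y = k t y x" if "0 \<le> t" for t x y
        using eta_sym[OF _ that, of x y] D_swap[of x y] D_swap[of y x]
        by (cases "(x, y) \<in> D") (auto simp: k_def indicator_def)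
      show "0 \<le> k t x y" "k t x y \<le> H" if "0 \<le> t" for t x y
        using eta[OF _ that, of "(x, y)"] H by (auto simp: k_def indicator_def)
      show "\<bar>k t x y - k s x y\<bar> \<le> (C_\<omega> + H) * (t - s)" if "0 \<le> s" "s \<le> t" for s t x y
        using eta_Lipschitz[OF _ that, of "(x, y)"] H omega_consts that by (auto simp: k_def indicator_def)
      show "r t \<in> borel_measurable \<mu>" if "0 \<le> t" for t
        using r_Linf[OF that] by (simp add: Linf_def)
      show "\<bar>r t x\<bar> \<le> R" if x: "x \<in> G" and t: "0 \<le> t" "t \<le> T" for t x
      proof (rule bounded_if_bounded_on_Rats[OF _ T(1) _ t, of "\<lambda>t. r t x"])
        have "((\<lambda>s. - fl x s) has_integral (r t x - r s x)) {s..t}" if "0 \<le> s" "s \<le> t" for s t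
          using has_integral_neg[of "fl x" "r s x - r t x"] x that by (simp add: G_def)
        then show "continuous_on {0..T} (\<lambda>t. r t x)"
          using T by (intro continuous_on_if_has_integral_increment) auto
      qed (use x in \<open>auto simp: G_def\<close>)
      show "((\<lambda>\<tau>. LINT y|\<mu>. Phi_upwind (r \<tau> x) (r \<tau> y) (\<alpha> (r \<tau> x) - \<alpha> (r \<tau> y)) * k \<tau> x y)
        has_integral (r s x - r t x)) {s..t}" if "x \<in> G" "0 \<le> s" "s \<le> t" for x s t
        using that by (simp add: G_def fl_def[abs_def])
    qed (use T H omega_consts R_nonneg UNIV_mu in auto)
    have init: "0 \<le> r 0 x" "r 0 x \<le> R0" if "x \<in> G" for x
      using that by (auto simp: G_def)
    have M_r: "(LINT x|\<mu>. r 0 x) = M"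
      unfolding M_eq
    proof (rule integral_cong_AE)
      show "AE x in \<mu>. r 0 x = r0 x"
        using AE_G by eventually_elim (simp add: G_def)
      show "r 0 \<in> borel_measurable \<mu>" using r_Linf[of 0] by (simp add: Linf_def)
    qed measurable
    \<comment> \<open>With \<open>c = 0\<close> the constant \<open>R0 \<ge> M\<close> is a
      supersolution, and \<open>drift\<close> reduces to nonnegativity of the kernel.\<close>
    have le_R0: "r s x \<le> R0" if "x \<in> G" "0 \<le> s" "s \<le> T" for s x
      by (rule flow.r_le_supersolution[of "\<lambda>_. R0" 0 "\<lambda>_. 0"])
        (use init that M M_r flow.k_nonneg in auto)
    have norm_le: "Linf_norm \<mu> (r t) \<le> c" if "\<And>x. x \<in> G \<Longrightarrow> r t x \<le> c" for c
    proof (rule Linf_norm_le)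
      show AE_c: "AE x in \<mu>. \<bar>r t x\<bar> \<le> c"
        using AE_G
      proof eventually_elim
        case (elim x)
        then show ?case using that[of x] flow.r_nonneg[OF init(1), of x t] t T by auto
      qed
      then have "AE x in \<mu>. 0 \<le> c" by eventually_elim linarith
      then show "0 \<le> c" by simp
      show "r t \<in> borel_measurable \<mu>" using r_Linf[OF t] by (simp add: Linf_def)
    qed
    have "r t x \<le> R0 * M * exp (A * E * M * t) / (R0 * (exp (A * E * M * t) - 1) + M)"
      if M_pos: "0 < M" and x: "x \<in> G" for x
    proof -
      define \<phi> where "\<phi> s = R0 * M * exp (A * E * M * s) / (R0 * (exp (A * E * M * s) - 1) + M)" for s
      have AE: "0 \<le> A * E" using A E(1) by simp
      note logistic = logistic[OF M_pos M(2) AE, folded \<phi>_def]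
      have "r t x \<le> \<phi> t"
      proof (rule flow.r_le_supersolution[of \<phi> "A * E" "\<lambda>s. - (A * E) * \<phi> s * (\<phi> s - M)", OF _ _ AE])
        show "r 0 x \<le> \<phi> 0" if "x \<in> G" for x
          using init[OF that] M_pos by (simp add: \<phi>_def)
        fix s x y assume s: "0 \<le> s" "s \<le> T" and xy: "x \<in> G" "y \<in> G"
        let ?w = "\<alpha> (r s x) - \<alpha> (r s y)"
        show "A * E * (r s x - r s y) \<le> max ?w 0 * k s x y"
        proof (cases "r s x \<le> r s y")
          case True
          then have "A * E * (r s x - r s y) \<le> 0"
            using AE by (intro mult_nonneg_nonpos) auto
          also have "0 \<le> max ?w 0 * k s x y"
            using flow.k_nonneg[OF s] by simp
          finally show ?thesis .
        next
          case False
          \<comment> \<open>Different values of \<open>r s\<close> force different points, so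
            \<open>E\<close> bounds the weight at this pair.\<close>
          then have "(x, y) \<in> D"
            using xy by (auto simp: G_def D_def K_def off_diag_def)
          then have kE: "E \<le> k s x y" using E(2)[OF s(1)] by (simp add: k_def)
          \<comment> \<open>The constant \<open>A\<close> belongs to \<open>[0, R0]\<close>;
            nonnegativity and the first estimate place both values of \<open>r s\<close> in this
            interval.\<close>
          have "A * (r s x - r s y) \<le> ?w"
            unfolding A_def using False flow.r_nonneg[OF init(1) xy(2) s] le_R0[OF xy(1) s]
            by (intro alpha_star_bounds(2)[OF alpha R0]) auto
          then have "A * (r s x - r s y) * E \<le> max ?w 0 * k s x y"
            using kE E(1) by (intro mult_mono) auto
          then show ?thesis by (simp add: mult_ac)
        qed
      qed (use init logistic M_r x t T in auto)
      then show ?thesis by (simp add: \<phi>_def)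
    qed
    then show ?thesis using norm_le le_R0 t T by auto
  qed

  \<comment> \<open>Normalisation and the two claims\<close>
  have measure_K: "measure \<mu> K = 1"
    using prob_eq_1[of K] AE_K K_borel mu(2) by simp
  have "Linf_norm \<mu> (r t) \<le> (R0 * A * E * M * exp (A * E * M * t)) /
      (A * E * (R0 * measure \<mu> K * (exp (A * E * M * t) - 1) + M))"
    if "E \<noteq> 0" and t: "0 \<le> t" for t
  proof (cases "M = 0")
    case True
    \<comment> \<open>Zero mass forces \<open>r0 = 0\<close> almost everywhere, hence
      \<open>R0 \<le> 0\<close>; the right-hand side is \<open>0\<close> and the first estimate
      suffices.\<close>
    then have "AE x in \<mu>. r0 x = 0"
      using integral_nonneg_eq_0_iff_AE[OF r0_int r0(2)] M_eq by simp
    then have "R0 \<le> 0"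
      unfolding R0_def using r0(1) by (intro Linf_norm_le) (auto simp: Linf_def)
    then show ?thesis using bounds[OF t] True by simp
  next
    case False
    \<comment> \<open>As \<open>A * E\<close> is nonzero and \<open>K\<close> has measure
      \<open>1\<close>, the fraction reduces to the logistic solution.\<close>
    then show ?thesis
      using bounds[OF t] M that A
        mult_divide_mult_cancel_left[of "A * E" "R0 * M * exp (A * E * M * t)"
          "R0 * (exp (A * E * M * t) - 1) + M"]
      by (simp add: measure_K mult_ac)
  qed
  moreover have "(SUP t\<in>{0..}. ereal (Linf_norm \<mu> (r t))) \<le> ereal R0"
    using bounds by (intro SUP_least) auto
  ultimately show ?thesis
    by (simp add: Let_def R0_def A_def E_def)
qed

end
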